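(* Let $\{X_t\}_{t\in\mathbb Z}$ be an SFIEGARCH$(p,d,q)_s$ process with $\gamma$ and $\theta$ not both equal to zero. Assume that $\alpha(z)\ne0$ for all $|z|\le1$. Let $Y_t:=\ln(\sigma_t^2)-\omega$ for all $t\in\mathbb Z$. Then $$\lim_{m\to\infty}\mathbb E\left(\left|\sum_{k=0}^m\tilde\lambda_{d,k}Y_{t-k}-g(Z_{t-1})\right|^{\mathfrak p}\right)=0\quad\text{for all }0<\mathfrak p\le2$$ if and only if $d\in(-1,0.5)$, where $\{\tilde\lambda_{d,k}\}_{k\in\mathbb N}$ is the sequence of coefficients in the series expansion $$\sum_{k=0}^\infty\tilde\lambda_{d,k}z^k=\tilde\lambda(z):=\lambda^{-1}(z)=\frac{\beta(z)}{\alpha(z)}(1-z^s)^d,\qquad|z|<1.$$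
   Context: $\mathbb N=\{0,1,2,\dots\}$. An SFIEGARCH$(p,d,q)_s$ process is a process $\{X_t\}_{t\in\mathbb Z}$ defined by $X_t=\sigma_tZ_t$ and $\ln(\sigma_t^2)=\omega+\sum_{k=0}^\infty\lambda_{d,k}g(Z_{t-1-k})$ for all $t\in\mathbb Z$, where: $\{Z_t\}_{t\in\mathbb Z}$ is i.i.d. with zero mean and variance one; $g(Z_t)=\theta Z_t+\gamma[|Z_t|-\mathbb E(|Z_t|)]$ with $\theta,\gamma\in\mathbb R$; $\omega,d\in\mathbb R$; $s\ge1$ is an integer; $\alpha(z)=\sum_{i=0}^p(-\alpha_i)z^i$ and $\beta(z)=\sum_{j=0}^q(-\beta_j)z^j$ are real polynomials of orders $p,q$ with $\alpha_0=\beta_0=-1$, without common roots, and $\beta(z)\neq0$ for $|z|\le1$; and $\lambda(z)=\frac{\alpha(z)}{\beta(z)}(1-z^s)^{-d}=\sum_{k=0}^\infty\lambda_{d,k}z^k$, $|z|<1$.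
   Formalization: The formal theorem also assumes that g(Z_0) is not almost surely zero; without this the claim fails, e.g. for P(Z=1)=P(Z=-1)=1/2, θ=0, γ=1, where Y_t=0 and g(Z_t)=0 a.s., so the limit is 0 for every d. *)

theory Defs
  imports
    "HOL-Probability.Probability"
    "HOL-Complex_Analysis.Complex_Analysis"
begin

text \<open>The polynomial \<open>\<Sum>i\<le>n. (-a\<^sub>i) z\<^sup>i\<close>, with real \<open>a\<^sub>i\<close>, as a polynomial over the complex numbers
  (roots and common roots are meant in the complex plane).\<close>

definition lag_poly :: "nat \<Rightarrow> (nat \<Rightarrow> real) \<Rightarrow> complex poly" where
  "lag_poly n a = (\<Sum>i\<le>n. monom (complex_of_real (- a i)) i)"

definition series_on_unit_disc :: "(nat \<Rightarrow> real) \<Rightarrow> (complex \<Rightarrow> complex) \<Rightarrow> bool" where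
  "series_on_unit_disc c f \<longleftrightarrow>
     (\<forall>z. norm z < 1 \<longrightarrow> (\<lambda>k. complex_of_real (c k) * z ^ k) sums f z)"

text \<open>\<open>g_fun M \<theta> \<gamma> U\<close> is the random variable \<open>g(U) = \<theta> U + \<gamma> (|U| - E|U|)\<close>.\<close>

definition g_fun :: "'a measure \<Rightarrow> real \<Rightarrow> real \<Rightarrow> ('a \<Rightarrow> real) \<Rightarrow> 'a \<Rightarrow> real" where
  "g_fun M \<theta> \<gamma> U x = \<theta> * U x + \<gamma> * (\<bar>U x\<bar> - (\<integral>y. \<bar>U y\<bar> \<partial>M))"

text \<open>
  The coefficients \<open>\<alpha>\<^sub>i\<close>, \<open>\<beta>\<^sub>j\<close> are \<open>a i\<close>, \<open>b j\<close>, and \<open>lam k\<close> is \<open>\<lambda>\<^bsub>d,k\<^esub>\<close>. The principal branch is the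
  right one in \<open>lam_series\<close>, since \<open>Re (1 - z ^ s) > 0\<close> on the unit disc. The volatility has to be
  nonzero for its logarithm to be meaningful (HOL has \<open>ln 0 = 0\<close>). The equations between random
  variables hold almost surely, the infinite series in \<open>volatility\<close> being the almost sure limit
  of its partial sums; in particular, its convergence is part of the definition of the process.
\<close>

locale sfiegarch = prob_space M
  for M :: "'a measure" +
  fixes X \<sigma> Z :: "int \<Rightarrow> 'a \<Rightarrow> real"
    and p q s :: nat
    and d \<omega> \<theta> \<gamma> :: real
    and a b lam :: "nat \<Rightarrow> real"
  assumes X_rv: "\<And>t. random_variable borel (X t)"
    and sigma_rv: "\<And>t. random_variable borel (\<sigma> t)"
    and Z_indep: "indep_vars (\<lambda>_. borel) Z UNIV"
    and Z_ident: "\<And>t u. distr M borel (Z t) = distr M borel (Z u)"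
    and Z_integrable: "\<And>t. integrable M (Z t)"
    and Z_sq_integrable: "\<And>t. integrable M (\<lambda>x. (Z t x)\<^sup>2)"
    and Z_mean: "\<And>t. expectation (Z t) = 0"
    and Z_variance: "\<And>t. variance (Z t) = 1"
    and s_pos: "s \<ge> 1"
    and a_0: "a 0 = -1"
    and b_0: "b 0 = -1"
    and degree_alpha: "degree (lag_poly p a) = p"
    and degree_beta: "degree (lag_poly q b) = q"
    and no_common_roots: "\<And>z. \<not> (poly (lag_poly p a) z = 0 \<and> poly (lag_poly q b) z = 0)"
    and beta_nonzero: "\<And>z. norm z \<le> 1 \<Longrightarrow> poly (lag_poly q b) z \<noteq> 0"
    and lam_series: "series_on_unit_disc lam
           (\<lambda>z. poly (lag_poly p a) z / poly (lag_poly q b) z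
                  * (1 - z ^ s) powr complex_of_real (- d))"
    and sigma_nonzero: "\<And>t. AE x in M. \<sigma> t x \<noteq> 0"
    and volatility: "\<And>t. AE x in M.
           (\<lambda>k. lam k * g_fun M \<theta> \<gamma> (Z (t - 1 - int k)) x) sums (ln ((\<sigma> t x)\<^sup>2) - \<omega>)"
    and observation: "\<And>t. AE x in M. X t x = \<sigma> t x * Z t x"

end

theory Submission
  imports Defs "HOL-Real_Asymp.Real_Asymp"
begin

text \<open>
  Put \<open>W\<^sub>t = g(Z\<^sub>t)\<close>. These variables are i.i.d. with mean zero and a variance \<open>v > 0\<close>, and
  \<open>Y\<^sub>t = \<Sum>\<^sub>j \<lambda>\<^sub>j W\<^bsub>t-1-j\<^esub>\<close> almost surely. The sequence \<open>\<lambda>'\<close> of coefficients of \<open>1/\<lambda>(z)\<close> is the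
  convolution inverse of \<open>\<lambda>\<close>. The series \<open>\<alpha>/\<beta>\<close> and \<open>\<beta>/\<alpha>\<close> converge on a disc of radius above one, so
  their coefficients decay geometrically and the size of \<open>\<lambda>\<close> and \<open>\<lambda>'\<close> is that of the binomial
  coefficients: \<open>\<lambda>\<^sub>k = O(k\<^bsup>d-1\<^esup>)\<close> and \<open>\<lambda>'\<^sub>k = O(k\<^bsup>-d-1\<^esup>)\<close>. Conversely, square summability of \<open>\<lambda>\<close>
  forces \<open>d < 1/2\<close>, and \<open>\<lambda>'\<^sub>k \<rightarrow> 0\<close> forces \<open>d > -1\<close>
  (locale \<open>seasonal_fractional_filter\<close>).

  Sufficiency. In \<open>\<Sum>\<^bsub>k\<le>m\<^esub> \<lambda>'\<^sub>k Y\<^bsub>t-k\<^esub>\<close>, cut the series of \<open>Y\<^bsub>t-k\<^esub>\<close> off after the index \<open>m - k\<close>. The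
  products that remain are those with \<open>k + j \<le> m\<close>, and since \<open>\<lambda>'\<close> inverts \<open>\<lambda>\<close> they add up to exactly
  \<open>W\<^bsub>t-1\<^esub>\<close> (\<open>truncated_inversion\<close>). So the error is \<open>\<Sum>\<^bsub>k\<le>m\<^esub> \<lambda>'\<^sub>k T\<^sub>k\<close>, where \<open>T\<^sub>k\<close> is the remainder of
  \<open>Y\<^bsub>t-k\<^esub>\<close> and has \<open>L\<^sup>2\<close> norm \<open>O((m-k+1)\<^bsup>d-1/2\<^esup>)\<close>. By the triangle inequality in \<open>L\<^sup>2\<close> the norm of
  the error is at most a constant times
  \<open>\<Sum>\<^bsub>k\<le>m\<^esub> (k+1)\<^bsup>-(d+1)\<^esup> (m-k+1)\<^bsup>-(1/2-d)\<^esup>\<close>. For \<open>-1 < d < 1/2\<close> both exponents \<open>d + 1\<close> and \<open>1/2 - d\<close>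
  are positive, and their sum is \<open>3/2 > 1\<close>, so this convolution tends to zero
  (\<open>powr_convolution_tendsto_0\<close>). Moments of order below two are controlled by the second moment.

  Necessity. The bound \<open>d < 1/2\<close> is imposed by the existence of the process: an almost surely
  convergent series \<open>\<Sum> \<lambda>\<^sub>k W\<^sub>k\<close> of i.i.d. variables with positive variance has square summable
  coefficients, as one sees from the characteristic functions of its partial sums
  (\<open>square_summable_if_AE_summable\<close>). The bound \<open>d > -1\<close> follows from convergence in \<open>L\<^sup>2\<close>: two
  consecutive errors differ by \<open>\<lambda>'\<^sub>m Y\<^bsub>t-m\<^esub>\<close>, and the second moment of \<open>Y\<close> is bounded below, so
  \<open>\<lambda>'\<^sub>m \<rightarrow> 0\<close> (\<open>inversion_coefficients_null\<close>).
\<close>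

section \<open>Coefficients of the seasonal binomial series\<close>

lemma powr_le_powr_of_comparable:
  fixes x y c e :: real
  assumes "0 < x" "0 < y" "x \<le> c * y" "y \<le> c * x"
  shows "x powr e \<le> c powr \<bar>e\<bar> * y powr e"
proof -
  have c: "0 < c" using assms by (metis less_le_trans zero_less_mult_pos2)
  show ?thesis
  proof (cases "e \<ge> 0")
    case True
    then have "x powr e \<le> (c * y) powr e" using assms by (intro powr_mono2) auto
    then show ?thesis using True assms c by (simp add: powr_mult)
  next
    case False
    have "x powr e \<le> (y / c) powr e"
      using assms False c by (intro powr_mono2') (auto simp: field_simps)
    also have "\<dots> = c powr \<bar>e\<bar> * y powr e"
      using False assms c by (simp add: powr_divide powr_minus field_simps)
    finally show ?thesis .
  qed
qed

text \<open>
  The expansion of \<open>(1 - z\<^sup>s)\<^sup>e\<close>. The substitution of \<open>- X\<^sup>s\<close> is made in two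
  stages, \<open>- X\<close> and then \<open>X\<^sup>s\<close>, because the coefficients of a composition with a pure power are those of the outer series,
  spread out.
\<close>

definition seasonal_binomial :: "nat \<Rightarrow> real \<Rightarrow> complex fps" where
  "seasonal_binomial s e = (fps_binomial (of_real e) oo (- fps_X)) oo fps_X ^ s"

lemma has_fps_expansion_seasonal_binomial:
  assumes "s \<ge> 1"
  shows "(\<lambda>z. (1 - z ^ s) powr complex_of_real e) has_fps_expansion seasonal_binomial s e"
proof -
  have 1: "((\<lambda>z. (1 + z) powr complex_of_real e) \<circ> (\<lambda>z. - z))
      has_fps_expansion (fps_binomial (of_real e) oo (- fps_X))"
    by (intro has_fps_expansion_compose has_fps_expansion_binomial_complex
        has_fps_expansion_minus has_fps_expansion_fps_X) auto
  have "(((\<lambda>z. (1 + z) powr complex_of_real e) \<circ> (\<lambda>z. - z)) \<circ> (\<lambda>z. z ^ s))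
      has_fps_expansion seasonal_binomial s e"
    unfolding seasonal_binomial_def
    by (intro has_fps_expansion_compose 1 has_fps_expansion_fps_X_power) (use assms in auto)
  then show ?thesis by (simp add: o_def)
qed

lemma nth_seasonal_binomial:
  assumes "s \<ge> 1"
  shows "fps_nth (seasonal_binomial s e) k =
    (if s dvd k then (-1) ^ (k div s) * (complex_of_real e gchoose (k div s)) else 0)"
  using assms unfolding seasonal_binomial_def
  by (simp add: fps_nth_compose_X_power fps_compose_uminus')

text \<open>
  Gauss's limit for the Gamma function, in the form \<open>|e choose n| \<sim> n\<^bsup>-e-1\<^esup> / |\<Gamma>(-e)|\<close>. The limit is
  nonzero for \<open>e < 0\<close>, so it also gives the lower bounds used below.
\<close>

lemma gbinomial_times_powr_tendsto:
  "(\<lambda>n. cmod (complex_of_real e gchoose n) * real n powr (e + 1))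
     \<longlonglongrightarrow> cmod (inverse (Gamma (- complex_of_real e)))"
proof (rule Lim_transform_eventually)
  show "(\<lambda>n. cmod ((complex_of_real e gchoose n) /
      ((-1)^n / exp ((complex_of_real e + 1) * of_real (ln (real n))))))
     \<longlonglongrightarrow> cmod (inverse (Gamma (- complex_of_real e)))"
    by (intro tendsto_norm gbinomial_asymptotic)
  show "\<forall>\<^sub>F n in sequentially. cmod ((complex_of_real e gchoose n) /
      ((-1)^n / exp ((complex_of_real e + 1) * of_real (ln (real n))))) =
     cmod (complex_of_real e gchoose n) * real n powr (e + 1)"
    using eventually_gt_at_top[of 0]
    by eventually_elim (simp add: norm_divide norm_power norm_mult powr_def)
qed

lemma seasonal_binomial_bound:
  assumes "s \<ge> 1"
  shows "\<exists>C>0. \<forall>k. cmod (fps_nth (seasonal_binomial s e) k) \<le> C * real (k + 1) powr (- e - 1)"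
proof -
  obtain K where K: "0 < K"
      "\<And>n. norm (cmod (complex_of_real e gchoose n) * real n powr (e + 1)) \<le> K"
    using convergent_imp_Bseq[OF convergentI[OF gbinomial_times_powr_tendsto[of e]]]
    unfolding Bseq_def by blast
  \<comment> \<open>The limit says nothing about \<open>k = 0\<close>, where the coefficient is 1; and \<open>2 * s\<close> compares \<open>n\<close>
    with \<open>s * n + 1\<close>.\<close>
  define C where "C = max 1 (K * (2 * real s) powr \<bar>- e - 1\<bar>)"
  have C: "C \<ge> 1" "C \<ge> K * (2 * real s) powr \<bar>- e - 1\<bar>" by (auto simp: C_def)
  show ?thesis
  proof (intro exI[of _ C] conjI allI)
    show "C > 0" using C by simp
    fix k
    show "cmod (fps_nth (seasonal_binomial s e) k) \<le> C * real (k + 1) powr (- e - 1)"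
    proof (cases "s dvd k \<and> k > 0")
      case True
      then obtain n where k: "k = s * n" by (elim conjE dvdE)
      with True have n: "n > 0" by auto
      have sn: "real n \<le> real s * real n" "real s * real n \<ge> 1" "real s \<ge> 1"
        using assms n by (auto simp: mult_ge1_I)
      have "cmod (complex_of_real e gchoose n) * real n powr (e + 1) \<le> K"
        using K(2)[of n] by simp
      then have "cmod (complex_of_real e gchoose n) \<le> K * real n powr (- e - 1)"
        using n by (simp add: powr_minus_divide[of _ "e+1", simplified] field_simps)
      also have "real n powr (- e - 1) \<le> (2 * real s) powr \<bar>- e - 1\<bar> * real (k + 1) powr (- e - 1)"
      proof (rule powr_le_powr_of_comparable)
        show "real n \<le> 2 * real s * real (k + 1)"
        proof -
          have "real n \<le> real s * real n" by fact
          also have "\<dots> \<le> real s * real (k + 1)" using sn k by (intro mult_left_mono) auto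
          also have "\<dots> \<le> 2 * real s * real (k + 1)" using sn by simp
          finally show ?thesis .
        qed
        have "real (k + 1) = real s * real n + 1" using k by simp
        also have "\<dots> \<le> 2 * real s * real n" using sn by linarith
        finally show "real (k + 1) \<le> 2 * real s * real n" .
      qed (use n in auto)
      finally have "cmod (complex_of_real e gchoose n) \<le>
          (K * (2 * real s) powr \<bar>- e - 1\<bar>) * real (k + 1) powr (- e - 1)"
        using K(1) by (simp add: mult_ac)
      also have "\<dots> \<le> C * real (k + 1) powr (- e - 1)"
        by (intro mult_right_mono C) auto
      finally show ?thesis using assms k
        by (simp add: nth_seasonal_binomial norm_mult norm_power)
    next
      case False
      then show ?thesis using C assms
        by (auto simp: nth_seasonal_binomial)
    qed
  qed
qed

text \<open>
  For \<open>e \<le> -1\<close> the factor \<open>n\<^bsup>e+1\<^esup>\<close> is at most one, so null coefficients would make the limit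
  \<open>1 / \<Gamma>(-e)\<close> vanish.
\<close>

lemma exponent_if_seasonal_binomial_null:
  assumes s: "s \<ge> 1" and null: "fps_nth (seasonal_binomial s e) \<longlonglongrightarrow> 0"
  shows "e > -1"
proof (rule ccontr)
  assume "\<not> e > -1"
  then have e: "e \<le> -1" by simp
  have "filterlim (\<lambda>n. s * n) sequentially sequentially"
    using s by (intro filterlim_subseq) (auto simp: strict_mono_def)
  from tendsto_norm_zero[OF filterlim_compose[OF null this]]
  have lim0: "(\<lambda>n. cmod (complex_of_real e gchoose n)) \<longlonglongrightarrow> 0"
    using s by (simp add: nth_seasonal_binomial norm_mult norm_power)
  have "(\<lambda>n. cmod (complex_of_real e gchoose n) * real n powr (e + 1)) \<longlonglongrightarrow> 0"
  proof (rule Lim_null_comparison[OF _ lim0])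
    show "\<forall>\<^sub>F n in sequentially. norm (cmod (complex_of_real e gchoose n) * real n powr (e + 1))
        \<le> cmod (complex_of_real e gchoose n)"
      using eventually_gt_at_top[of 0]
    proof eventually_elim
      case (elim n)
      have "real n powr (e + 1) \<le> real n powr 0" using elim e by (intro powr_mono) auto
      then show ?case using elim by (simp add: mult_left_le)
    qed
  qed
  from LIMSEQ_unique[OF this gbinomial_times_powr_tendsto]
  have "Gamma (- complex_of_real e) = 0" by simp
  moreover have "Gamma (- e) \<noteq> 0" using e Gamma_real_pos[of "-e"] by linarith
  ultimately show False
    by (metis Gamma_complex_of_real of_real_eq_0_iff of_real_minus)
qed

text \<open>
  For \<open>e \<le> -1/2\<close> the squared coefficients at the multiples of \<open>s\<close> are eventually at least a constant
  times \<open>n\<^bsup>-2e-2\<^esup> \<ge> 1/n\<close>, and the harmonic series diverges.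
\<close>

lemma exponent_if_seasonal_binomial_square_summable:
  assumes s: "s \<ge> 1" and sq: "summable (\<lambda>k. (cmod (fps_nth (seasonal_binomial s e) k))\<^sup>2)"
  shows "e > -1/2"
proof (rule ccontr)
  assume "\<not> e > -1/2"
  then have e: "e \<le> -1/2" by simp
  let ?l = "cmod (inverse (Gamma (- complex_of_real e)))"
  have "Gamma (- e) \<noteq> 0" using e Gamma_real_pos[of "-e"] by linarith
  then have l: "?l > 0"
    by (metis Gamma_complex_of_real of_real_eq_0_iff of_real_minus zero_less_norm_iff
        inverse_nonzero_iff_nonzero)
  have "summable (\<lambda>n. (cmod (fps_nth (seasonal_binomial s e) (s * n)))\<^sup>2)"
    using s sq
    by (subst summable_mono_reindex[where g = "\<lambda>n. s * n"
          and f = "\<lambda>k. (cmod (fps_nth (seasonal_binomial s e) k))\<^sup>2"])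
      (auto simp: strict_mono_def nth_seasonal_binomial image_iff elim!: dvdE)
  then have sq': "summable (\<lambda>n. (cmod (complex_of_real e gchoose n))\<^sup>2)"
    using s by (simp add: nth_seasonal_binomial norm_mult norm_power)
  have "\<forall>\<^sub>F n in sequentially. cmod (complex_of_real e gchoose n) * real n powr (e + 1) > ?l / 2"
    using order_tendstoD(1)[OF gbinomial_times_powr_tendsto, of "?l / 2" e] l by simp
  then have "\<forall>\<^sub>F n in sequentially. norm (inverse (real n)) \<le>
      (4 / ?l\<^sup>2) * (cmod (complex_of_real e gchoose n))\<^sup>2"
    using eventually_gt_at_top[of 0]
  proof eventually_elim
    case (elim n)
    define c where "c = cmod (complex_of_real e gchoose n)"
    have "?l / 2 \<le> c * real n powr (e + 1)" using elim by (simp add: c_def)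
    also have "\<dots> \<le> c * real n powr (1/2)"
      using elim e by (intro mult_left_mono powr_mono) (auto simp: c_def)
    finally have "(?l / 2)\<^sup>2 \<le> (c * real n powr (1/2))\<^sup>2" using l by (intro power_mono) auto
    also have "(c * real n powr (1/2))\<^sup>2 = c\<^sup>2 * real n"
      by (simp add: power_mult_distrib powr_half_sqrt)
    finally have "?l\<^sup>2 \<le> 4 * c\<^sup>2 * real n" by (simp add: power_divide)
    then show ?case using l elim unfolding c_def[symmetric]
      by (simp add: field_simps)
  qed
  then have "summable (\<lambda>n. inverse (real n))"
    by (rule summable_comparison_test_ev) (intro summable_mult sq')
  then show False using not_summable_harmonic by blast
qed

section \<open>Multiplication by a series with geometrically decaying coefficients\<close>

lemma summable_norm_times_powr:
  fixes G :: "complex fps"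
  assumes "fps_conv_radius G > 1"
  shows "summable (\<lambda>i. cmod (fps_nth G i) * real (i + 1) powr e)"
proof -
  obtain r where r: "1 < ereal r" "ereal r < fps_conv_radius G"
    using ereal_dense2[OF assms] by blast
  then have r1: "r > 1" by simp
  have lim: "(\<lambda>i::nat. real (i + 1) powr e / r ^ i) \<longlonglongrightarrow> 0"
  proof -
    define q where "q = ln r"
    have "q > 0" using r1 by (simp add: q_def)
    then have "(\<lambda>i::nat. real (i + 1) powr e / exp (q * real i)) \<longlonglongrightarrow> 0" by real_asymp
    moreover have "exp (q * real i) = r ^ i" for i
      using r1 by (simp add: q_def exp_of_nat2_mult)
    ultimately show ?thesis by simp
  qed
  obtain K where K: "K > 0" "\<And>i::nat. norm (real (i + 1) powr e / r ^ i) \<le> K"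
    using convergent_imp_Bseq[OF convergentI[OF lim]] unfolding Bseq_def by blast
  have "summable (\<lambda>i. K * norm (fps_nth G i * complex_of_real r ^ i))"
    by (intro summable_mult norm_summable_fps) (use r r1 in auto)
  then show ?thesis
  proof (rule summable_comparison_test')
    fix i :: nat
    have "real (i + 1) powr e \<le> K * r ^ i" using K(2)[of i] r1 by (simp add: field_simps)
    then have "cmod (fps_nth G i) * real (i + 1) powr e \<le> cmod (fps_nth G i) * (K * r ^ i)"
      by (intro mult_left_mono) auto
    then show "norm (cmod (fps_nth G i) * real (i + 1) powr e) \<le>
        K * norm (fps_nth G i * complex_of_real r ^ i)"
      using r1 by (simp add: norm_mult norm_power mult_ac)
  qed
qed

lemma summable_norm_fps_nth:
  fixes G :: "complex fps"
  assumes "fps_conv_radius G > 1"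
  shows "summable (\<lambda>i. cmod (fps_nth G i))"
  using norm_summable_fps[of 1 G] assms by (simp add: one_ereal_def)

text \<open>
  The weight \<open>(i+1)\<^bsup>|e|\<^esup>\<close> pays for moving the bound from \<open>k - i\<close> to \<open>k\<close>, for either sign of \<open>e\<close>,
  because \<open>k + 1 \<le> (i + 1) (k - i + 1)\<close>. It is absorbed by the geometric decay of \<open>G\<close>.
\<close>

lemma fps_mult_polynomial_bound:
  fixes G P :: "complex fps"
  assumes G: "fps_conv_radius G > 1" and "C \<ge> 0"
    and P: "\<And>k. cmod (fps_nth P k) \<le> C * real (k + 1) powr e"
  shows "\<exists>C'>0. \<forall>k. cmod (fps_nth (G * P) k) \<le> C' * real (k + 1) powr e"
proof -
  let ?w = "\<lambda>i. cmod (fps_nth G i) * real (i + 1) powr \<bar>e\<bar>"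
  have w: "summable ?w" by (rule summable_norm_times_powr[OF G])
  show ?thesis
  proof (intro exI[of _ "C * suminf ?w + 1"] conjI allI)
    show "0 < C * suminf ?w + 1"
      using \<open>C \<ge> 0\<close> by (intro add_nonneg_pos mult_nonneg_nonneg suminf_nonneg w) auto
    fix k
    have "cmod (fps_nth (G * P) k) \<le> (\<Sum>i=0..k. cmod (fps_nth G i * fps_nth P (k - i)))"
      unfolding fps_mult_nth by (rule norm_sum)
    also have "\<dots> \<le> (\<Sum>i=0..k. C * real (k + 1) powr e * ?w i)"
    proof (rule sum_mono)
      fix i assume i: "i \<in> {0..k}"
      have "real (k - i + 1) powr e \<le> real (i + 1) powr \<bar>e\<bar> * real (k + 1) powr e"
      proof (rule powr_le_powr_of_comparable)
        have "real (k - i + 1) \<le> 1 * real (k + 1)" by simp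
        also have "\<dots> \<le> real (i + 1) * real (k + 1)" by (intro mult_right_mono) auto
        finally show "real (k - i + 1) \<le> real (i + 1) * real (k + 1)" .
        have "k + 1 \<le> (i + 1) * (k - i + 1)" using i by auto
        then show "real (k + 1) \<le> real (i + 1) * real (k - i + 1)"
          by (metis of_nat_le_iff of_nat_mult)
      qed auto
      then have "cmod (fps_nth P (k - i)) \<le> C * (real (i + 1) powr \<bar>e\<bar> * real (k + 1) powr e)"
        using P[of "k - i"] \<open>C \<ge> 0\<close> by (meson mult_left_mono order_trans)
      then have "cmod (fps_nth G i) * cmod (fps_nth P (k - i)) \<le>
          cmod (fps_nth G i) * (C * (real (i + 1) powr \<bar>e\<bar> * real (k + 1) powr e))"
        by (intro mult_left_mono) auto
      then show "cmod (fps_nth G i * fps_nth P (k - i)) \<le> C * real (k + 1) powr e * ?w i"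
        by (simp add: norm_mult mult_ac)
    qed
    also have "\<dots> = C * real (k + 1) powr e * (\<Sum>i=0..k. ?w i)"
      by (simp add: sum_distrib_left)
    also have "\<dots> \<le> C * real (k + 1) powr e * suminf ?w"
      using \<open>C \<ge> 0\<close> by (intro mult_left_mono sum_le_suminf w) auto
    also have "\<dots> \<le> (C * suminf ?w + 1) * real (k + 1) powr e"
      by (simp add: algebra_simps)
    finally show "cmod (fps_nth (G * P) k) \<le> (C * suminf ?w + 1) * real (k + 1) powr e" .
  qed
qed

text \<open>
  Young's inequality for the convolution of a summable and a square summable sequence, from
  Cauchy--Schwarz with the weights \<open>|G\<^sub>i|\<close>: \<open>(\<Sum>|G\<^sub>i||L\<^bsub>k-i\<^esub>|)\<^sup>2 \<le> (\<Sum>|G\<^sub>i|) (\<Sum>|G\<^sub>i||L\<^bsub>k-i\<^esub>|\<^sup>2)\<close>.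
\<close>

lemma fps_mult_square_summable:
  fixes G L :: "complex fps"
  assumes G: "summable (\<lambda>i. cmod (fps_nth G i))"
    and L: "summable (\<lambda>k. (cmod (fps_nth L k))\<^sup>2)"
  shows "summable (\<lambda>k. (cmod (fps_nth (G * L) k))\<^sup>2)"
proof -
  let ?g = "\<lambda>i. cmod (fps_nth G i)" and ?l = "\<lambda>k. cmod (fps_nth L k)"
  have "summable (\<lambda>k. suminf ?g * (\<Sum>i\<le>k. ?g i * (?l (k - i))\<^sup>2))"
    using summable_Cauchy_product[of ?g "\<lambda>k. (?l k)\<^sup>2"] G L
    by (intro summable_mult) auto
  then show ?thesis
  proof (rule summable_comparison_test')
    fix k :: nat
    have "cmod (fps_nth (G * L) k) \<le> (\<Sum>i\<le>k. ?g i * ?l (k - i))"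
      unfolding fps_mult_nth atLeast0AtMost norm_mult[symmetric] by (rule norm_sum)
    also have "\<dots> = (\<Sum>i\<le>k. sqrt (?g i) * (sqrt (?g i) * ?l (k - i)))"
      by (intro sum.cong refl) (metis abs_norm_cancel mult.assoc real_sqrt_mult_self)
    finally have "(cmod (fps_nth (G * L) k))\<^sup>2 \<le>
        (\<Sum>i\<le>k. sqrt (?g i) * (sqrt (?g i) * ?l (k - i)))\<^sup>2"
      by (rule power_mono) simp
    also have "\<dots> \<le> (\<Sum>i\<le>k. (sqrt (?g i))\<^sup>2) * (\<Sum>i\<le>k. (sqrt (?g i) * ?l (k - i))\<^sup>2)"
      by (rule Cauchy_Schwarz_ineq_sum)
    also have "\<dots> = (\<Sum>i\<le>k. ?g i) * (\<Sum>i\<le>k. ?g i * (?l (k - i))\<^sup>2)"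
      by (simp add: power_mult_distrib)
    also have "\<dots> \<le> suminf ?g * (\<Sum>i\<le>k. ?g i * (?l (k - i))\<^sup>2)"
      by (intro mult_right_mono sum_le_suminf G sum_nonneg) auto
    finally show "norm ((cmod (fps_nth (G * L) k))\<^sup>2) \<le>
        suminf ?g * (\<Sum>i\<le>k. ?g i * (?l (k - i))\<^sup>2)" by simp
  qed
qed

text \<open>
  Dominated convergence for sums (Tannery): each term \<open>G\<^sub>i L\<^bsub>k-i\<^esub>\<close> tends to zero in \<open>k\<close> and is bounded by a
  multiple of \<open>|G\<^sub>i|\<close>.
\<close>

lemma fps_mult_null:
  fixes G L :: "complex fps"
  assumes G: "summable (\<lambda>i. cmod (fps_nth G i))" and L: "fps_nth L \<longlonglongrightarrow> 0"
  shows "fps_nth (G * L) \<longlonglongrightarrow> 0"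
proof -
  obtain K where K: "K > 0" "\<And>k. cmod (fps_nth L k) \<le> K"
    using convergent_imp_Bseq[OF convergentI[OF L]] unfolding Bseq_def by blast
  let ?a = "\<lambda>i k. if i \<le> k then fps_nth G i * fps_nth L (k - i) else 0"
  have lim: "(\<lambda>k. ?a i k) \<longlonglongrightarrow> 0" for i
  proof -
    have "(\<lambda>k. fps_nth G i * fps_nth L (k - i)) \<longlonglongrightarrow> fps_nth G i * 0"
      by (intro tendsto_mult tendsto_const filterlim_compose[OF L] filterlim_minus_const_nat_at_top)
    then have "(\<lambda>k. fps_nth G i * fps_nth L (k - i)) \<longlonglongrightarrow> 0" by simp
    then show ?thesis
      by (rule Lim_transform_eventually)
        (rule eventually_mono[OF eventually_ge_at_top[of i]], simp)
  qed
  have "(\<lambda>k. suminf (\<lambda>i. ?a i k)) \<longlonglongrightarrow> suminf (\<lambda>i. 0::complex)"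
  proof (rule tannerys_theorem[THEN conjunct2, THEN conjunct2])
    show "\<forall>\<^sub>F (i, k) in at_top \<times>\<^sub>F sequentially. norm (?a i k) \<le> K * cmod (fps_nth G i)"
      using K by (intro always_eventually) (auto simp: norm_mult mult.commute[of K] intro!: mult_left_mono)
    show "summable (\<lambda>i. K * cmod (fps_nth G i))" by (intro summable_mult G)
  qed (use lim in auto)
  moreover have "suminf (\<lambda>i. ?a i k) = fps_nth (G * L) k" for k
    by (subst suminf_finite[of "{0..k}"]) (auto simp: fps_mult_nth intro!: sum.cong)
  ultimately show ?thesis by (simp add: fun_eq_iff)
qed

section \<open>Seasonal fractional filters\<close>

text \<open>
  A polynomial has finitely many zeros, so the absence of zeros in the closed unit disc extends to a
  larger disc.
\<close>

lemma fps_conv_radius_inverse_poly_gt_1: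
  fixes p :: "complex poly"
  assumes nz: "\<And>z. cmod z \<le> 1 \<Longrightarrow> poly p z \<noteq> 0"
  shows "fps_conv_radius (inverse (fps_of_poly p)) > 1"
proof -
  have "poly p 0 \<noteq> 0" by (rule nz) simp
  then have fin: "finite {z. poly p z = 0}" by (intro poly_roots_finite) auto
  define r where "r = Min (insert 2 (cmod ` {z. poly p z = 0}))"
  have r1: "r > 1" unfolding r_def using fin nz by (subst Min_gr_iff) force+
  have "poly p z \<noteq> 0" if "cmod z < r" for z
    using that fin unfolding r_def by (subst (asm) Min_gr_iff) auto
  then have "fps_conv_radius (inverse (fps_of_poly p)) \<ge> min (ereal r) (fps_conv_radius (fps_of_poly p))"
    by (intro fps_conv_radius_inverse) auto
  then have "ereal r \<le> fps_conv_radius (inverse (fps_of_poly p))" by simp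
  moreover have "1 < ereal r" using r1 by simp
  ultimately show ?thesis by (metis less_le_trans)
qed

lemma fps_conv_radius_poly_over_poly_gt_1:
  fixes A B :: "complex poly"
  assumes nz: "\<And>z. cmod z \<le> 1 \<Longrightarrow> poly B z \<noteq> 0"
  shows "fps_conv_radius (fps_of_poly A * inverse (fps_of_poly B)) > 1"
  using fps_conv_radius_mult[of "fps_of_poly A" "inverse (fps_of_poly B)"]
    fps_conv_radius_inverse_poly_gt_1[OF nz] by simp

abbreviation cfps :: "(nat \<Rightarrow> real) \<Rightarrow> complex fps" where
  "cfps c \<equiv> Abs_fps (\<lambda>k. complex_of_real (c k))"

lemma has_fps_expansion_series_on_unit_disc:
  assumes "series_on_unit_disc c f"
  shows "f has_fps_expansion cfps c"
proof (rule has_fps_expansionI)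
  have "\<forall>\<^sub>F z in nhds (0::complex). z \<in> ball 0 1" by (intro eventually_nhds_in_open) auto
  then show "\<forall>\<^sub>F z in nhds 0. (\<lambda>n. fps_nth (cfps c) n * z ^ n) sums f z"
    by eventually_elim (use assms in \<open>auto simp: series_on_unit_disc_def\<close>)
qed

text \<open>
  This covers both \<open>\<lambda>\<close> (with \<open>e = -d\<close>) and its inverse (with \<open>e = d\<close> and the two polynomials
  exchanged). Since neither polynomial has a zero in the closed disc, \<open>c\<close> and the seasonal binomial
  coefficients are obtained from each other by convolution with a geometrically decaying sequence; hence
  upper bounds pass from the latter to \<open>c\<close>, and summability or convergence to zero passes back from
  \<open>c\<close>.
\<close>

locale seasonal_fractional_filter =
  fixes A B :: "complex poly" and s :: nat and e :: real and c :: "nat \<Rightarrow> real"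
  assumes s_pos: "s \<ge> 1"
    and A_nonzero: "\<And>z. cmod z \<le> 1 \<Longrightarrow> poly A z \<noteq> 0"
    and B_nonzero: "\<And>z. cmod z \<le> 1 \<Longrightarrow> poly B z \<noteq> 0"
    and series: "series_on_unit_disc c
      (\<lambda>z. poly A z / poly B z * (1 - z ^ s) powr complex_of_real e)"
begin

lemma cfps_eq:
  "cfps c = (fps_of_poly A * inverse (fps_of_poly B)) * seasonal_binomial s e"
proof (rule fps_expansion_unique_complex)
  have has: "poly Q has_fps_expansion fps_of_poly Q" for Q :: "complex poly"
    by (simp add: has_fps_expansion_def)
  have "poly B 0 \<noteq> 0" by (rule B_nonzero) simp
  then show "(\<lambda>z. (poly A z * inverse (poly B z)) * (1 - z ^ s) powr complex_of_real e)
      has_fps_expansion (fps_of_poly A * inverse (fps_of_poly B)) * seasonal_binomial s e"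
    by (intro has_fps_expansion_mult has_fps_expansion_inverse has
        has_fps_expansion_seasonal_binomial s_pos) (auto simp: poly_0_coeff_0)
  show "(\<lambda>z. (poly A z * inverse (poly B z)) * (1 - z ^ s) powr complex_of_real e)
      has_fps_expansion cfps c"
    using has_fps_expansion_series_on_unit_disc[OF series] by (simp add: divide_inverse)
qed

lemma seasonal_binomial_eq:
  "seasonal_binomial s e = (fps_of_poly B * inverse (fps_of_poly A)) * cfps c"
proof -
  have "poly A 0 \<noteq> 0" "poly B 0 \<noteq> 0" by (simp_all add: A_nonzero B_nonzero)
  then have "fps_nth (fps_of_poly A) 0 \<noteq> 0" "fps_nth (fps_of_poly B) 0 \<noteq> 0"
    by (auto simp: poly_0_coeff_0)
  then have inv: "inverse (fps_of_poly A) * fps_of_poly A = 1"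
      "inverse (fps_of_poly B) * fps_of_poly B = 1"
    by (auto intro: inverse_mult_eq_1)
  have "(fps_of_poly B * inverse (fps_of_poly A)) * cfps c =
      (inverse (fps_of_poly A) * fps_of_poly A) * (inverse (fps_of_poly B) * fps_of_poly B) *
        seasonal_binomial s e"
    unfolding cfps_eq by (simp only: mult_ac)
  then show ?thesis by (simp add: inv)
qed

lemma coefficient_bound: "\<exists>C>0. \<forall>k. \<bar>c k\<bar> \<le> C * real (k + 1) powr (- e - 1)"
proof -
  obtain C where "C > 0" "\<And>k. cmod (fps_nth (seasonal_binomial s e) k) \<le> C * real (k + 1) powr (- e - 1)"
    using seasonal_binomial_bound[OF s_pos] by blast
  from fps_mult_polynomial_bound[OF fps_conv_radius_poly_over_poly_gt_1[OF B_nonzero] _ this(2), of A]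
  obtain C' where "C' > 0"
      "\<And>k. cmod (fps_nth (cfps c) k) \<le> C' * real (k + 1) powr (- e - 1)"
    unfolding cfps_eq using \<open>C > 0\<close> by auto
  then show ?thesis by auto
qed

lemma exponent_if_square_summable:
  assumes "summable (\<lambda>k. (c k)\<^sup>2)"
  shows "e > -1/2"
proof -
  have "summable (\<lambda>k. (cmod (fps_nth (cfps c) k))\<^sup>2)" using assms by simp
  from fps_mult_square_summable[OF
      summable_norm_fps_nth[OF fps_conv_radius_poly_over_poly_gt_1[OF A_nonzero]] this, of B]
  show ?thesis
    unfolding seasonal_binomial_eq[symmetric]
    by (rule exponent_if_seasonal_binomial_square_summable[OF s_pos])
qed

lemma exponent_if_null:
  assumes "c \<longlonglongrightarrow> 0"
  shows "e > -1"
proof -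
  have "fps_nth (cfps c) \<longlonglongrightarrow> 0" using tendsto_of_real[OF assms, where 'a=complex]
    by (simp add: fps_nth_Abs_fps[abs_def])
  from fps_mult_null[OF
      summable_norm_fps_nth[OF fps_conv_radius_poly_over_poly_gt_1[OF A_nonzero]] this, of B]
  show ?thesis
    unfolding seasonal_binomial_eq[symmetric]
    by (rule exponent_if_seasonal_binomial_null[OF s_pos])
qed

end

lemma seasonal_binomial_mult_minus:
  assumes "s \<ge> 1"
  shows "seasonal_binomial s e * seasonal_binomial s (- e) = 1"
proof (rule fps_expansion_unique_complex)
  show "(\<lambda>z. (1 - z ^ s) powr complex_of_real e * (1 - z ^ s) powr complex_of_real (- e))
      has_fps_expansion seasonal_binomial s e * seasonal_binomial s (- e)"
    by (intro has_fps_expansion_mult has_fps_expansion_seasonal_binomial assms)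
  have "\<forall>\<^sub>F z in nhds (0::complex). z \<in> ball 0 1" by (intro eventually_nhds_in_open) auto
  then have "\<forall>\<^sub>F z in nhds (0::complex).
      1 = (1 - z ^ s) powr complex_of_real e * (1 - z ^ s) powr complex_of_real (- e)"
  proof eventually_elim
    case (elim z)
    have "cmod z ^ s < 1"
      using elim assms power_decreasing[of 1 s "cmod z"] by auto
    then have "cmod (z ^ s) \<noteq> 1" by (simp add: norm_power)
    then have "1 - z ^ s \<noteq> 0" by auto
    then show ?case by (simp flip: powr_add)
  qed
  then show "(\<lambda>z. (1 - z ^ s) powr complex_of_real e * (1 - z ^ s) powr complex_of_real (- e))
      has_fps_expansion 1"
    by (simp add: has_fps_expansion_def)
qed

text \<open>
  The product of \<open>B/A \<cdot> (1 - z\<^sup>s)\<^sup>e\<close> and \<open>A/B \<cdot> (1 - z\<^sup>s)\<^bsup>-e\<^esup>\<close> is one, compared coefficientwise.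
\<close>

lemma inverse_filter_convolution:
  assumes "seasonal_fractional_filter A B s (- e) c"
    and "seasonal_fractional_filter B A s e c'"
  shows "(\<Sum>k\<le>n. c' k * c (n - k)) = (if n = 0 then 1 else 0)"
proof -
  interpret f: seasonal_fractional_filter A B s "- e" c by fact
  interpret g: seasonal_fractional_filter B A s e c' by fact
  have "cfps c' * cfps c =
      (fps_of_poly B * inverse (fps_of_poly A) * cfps c) * seasonal_binomial s e"
    unfolding g.cfps_eq by (simp only: mult_ac)
  also have "\<dots> = 1"
    unfolding f.seasonal_binomial_eq[symmetric]
    using seasonal_binomial_mult_minus[OF f.s_pos, of "- e"] by simp
  finally have "fps_nth (cfps c' * cfps c) n = fps_nth 1 n" by simp
  then have "complex_of_real (\<Sum>k\<le>n. c' k * c (n - k)) = complex_of_real (if n = 0 then 1 else 0)"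
    by (simp add: fps_mult_nth atLeast0AtMost)
  then show ?thesis by (simp only: of_real_eq_iff)
qed

section \<open>Convolutions of powers\<close>

lemma powr_increment_bound:
  assumes q: "q > 1" and x: "x > (0::real)"
  shows "(q - 1) * (x + 1) powr (- q) \<le> x powr (1 - q) - (x + 1) powr (1 - q)"
proof -
  have "\<exists>\<xi>>x. \<xi> < x + 1 \<and>
      (x + 1) powr (1 - q) - x powr (1 - q) = (x + 1 - x) * ((1 - q) * \<xi> powr (1 - q - 1))"
    using x by (intro MVT2 has_real_derivative_powr) auto
  then obtain \<xi> where \<xi>: "x < \<xi>" "\<xi> < x + 1"
      "(x + 1) powr (1 - q) - x powr (1 - q) = (x + 1 - x) * ((1 - q) * \<xi> powr (1 - q - 1))"
    by blast
  have "(x + 1) powr (- q) \<le> \<xi> powr (- q)"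
    using \<xi> x q by (intro powr_mono2') auto
  then have "(q - 1) * (x + 1) powr (- q) \<le> (q - 1) * \<xi> powr (- q)"
    using q by (intro mult_left_mono) auto
  then show ?thesis using \<xi>(3) by (simp add: algebra_simps)
qed

text \<open>
  Comparison with the integral of \<open>x\<^bsup>-q\<^esup>\<close>, carried out by telescoping the increments of its primitive
  \<open>x\<^bsup>1-q\<^esup> / (1 - q)\<close>.
\<close>

lemma powr_tail_bound:
  assumes q: "q > 1" and "N \<le> M"
  shows "(\<Sum>j\<in>{N<..M}. real (j + 1) powr (- q)) \<le> real (N + 1) powr (1 - q) / (q - 1)"
proof -
  have "(q - 1) * (\<Sum>j\<in>{N<..M}. real (j + 1) powr (- q)) \<le>
      real (N + 1) powr (1 - q) - real (M + 1) powr (1 - q)"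
    using \<open>N \<le> M\<close>
  proof (induction M rule: dec_induct)
    case (step M)
    have "{N<..Suc M} = insert (Suc M) {N<..M}" using step by auto
    then show ?case
      using step powr_increment_bound[OF q, of "real (M + 1)"] by (simp add: algebra_simps)
  qed simp
  also have "\<dots> \<le> real (N + 1) powr (1 - q)" by simp
  finally show ?thesis using q by (simp add: field_simps)
qed

text \<open>
  The pointwise estimate behind the convergence of the convolution below, with \<open>y\<close> the larger
  base.
\<close>

lemma powr_mult_powr_le_of_le:
  assumes "0 < x" "x \<le> y" "h \<le> y" "0 < h" "0 < \<epsilon>" "\<epsilon> \<le> (b::real)"
  shows "x powr (- a) * y powr (- b) \<le> h powr (- \<epsilon>) * x powr (- (a + b - \<epsilon>))"
proof -
  have "y powr (- b) = y powr (- \<epsilon>) * y powr (- (b - \<epsilon>))" by (simp flip: powr_add)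
  also have "\<dots> \<le> h powr (- \<epsilon>) * x powr (- (b - \<epsilon>))"
    using assms by (intro mult_mono powr_mono2') auto
  finally have "x powr (- a) * y powr (- b) \<le> x powr (- a) * (h powr (- \<epsilon>) * x powr (- (b - \<epsilon>)))"
    by (intro mult_left_mono) auto
  also have "\<dots> = h powr (- \<epsilon>) * x powr (- (a + b - \<epsilon>))"
    by (simp add: algebra_simps flip: powr_add)
  finally show ?thesis .
qed

text \<open>
  In every summand the larger of the two bases is at least \<open>h = (m + 2)/2\<close>. Taking a small power
  \<open>\<epsilon>\<close> of it out as \<open>h\<^bsup>-\<epsilon>\<^esup>\<close> and lowering the rest to the smaller base leaves a power of the smaller base
  with exponent \<open>-(a + b - \<epsilon>)\<close>. This is still summable as \<open>a + b > 1\<close>, and \<open>h\<^bsup>-\<epsilon>\<^esup> \<rightarrow> 0\<close>. The summands with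
  either base as the smaller one are treated symmetrically.
\<close>

lemma powr_convolution_tendsto_0:
  fixes a b :: real
  assumes "0 < a" "0 < b" "1 < a + b"
  shows "(\<lambda>m. \<Sum>k\<le>m. real (k + 1) powr (- a) * real (m - k + 1) powr (- b)) \<longlonglongrightarrow> 0"
proof -
  define \<epsilon> where "\<epsilon> = min (min a b) ((a + b - 1) / 2)"
  define q where "q = a + b - \<epsilon>"
  have eps: "0 < \<epsilon>" "\<epsilon> \<le> a" "\<epsilon> \<le> b" and q: "q > 1"
    using assms by (auto simp: \<epsilon>_def q_def min_def field_simps)
  define S where "S = 1 + 1 / (q - 1)"
  let ?u = "\<lambda>k. real (k + 1) powr (- q)"
  have S: "(\<Sum>k\<le>m. ?u k) \<le> S" for m
  proof -
    have "{..m} = insert 0 {0<..m}" by auto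
    then show ?thesis using powr_tail_bound[OF q, of 0 m] by (simp add: S_def)
  qed
  have bound: "(\<Sum>k\<le>m. real (k + 1) powr (- a) * real (m - k + 1) powr (- b))
      \<le> 2 * S * (real (m + 2) / 2) powr (- \<epsilon>)" for m
  proof -
    let ?h = "real (m + 2) / 2"
    have "(\<Sum>k\<le>m. real (k + 1) powr (- a) * real (m - k + 1) powr (- b))
        \<le> (\<Sum>k\<le>m. ?h powr (- \<epsilon>) * (?u k + ?u (m - k)))"
    proof (rule sum_mono)
      fix k assume k: "k \<in> {..m}"
      show "real (k + 1) powr (- a) * real (m - k + 1) powr (- b)
          \<le> ?h powr (- \<epsilon>) * (?u k + ?u (m - k))"
      proof (cases "k + 1 \<le> m - k + 1")
        case True
        have "real (k + 1) powr (- a) * real (m - k + 1) powr (- b) \<le> ?h powr (- \<epsilon>) * ?u k"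
          unfolding q_def using True eps k by (intro powr_mult_powr_le_of_le) auto
        also have "\<dots> \<le> ?h powr (- \<epsilon>) * (?u k + ?u (m - k))" by (intro mult_left_mono) auto
        finally show ?thesis .
      next
        case False
        have "real (m - k + 1) powr (- b) * real (k + 1) powr (- a)
            \<le> ?h powr (- \<epsilon>) * real (m - k + 1) powr (- (b + a - \<epsilon>))"
          using False eps k by (intro powr_mult_powr_le_of_le) auto
        also have "b + a - \<epsilon> = q" by (simp add: q_def)
        also have "?h powr (- \<epsilon>) * ?u (m - k) \<le> ?h powr (- \<epsilon>) * (?u k + ?u (m - k))"
          by (intro mult_left_mono) auto
        finally show ?thesis by (simp add: mult.commute)
      qed
    qed
    also have "\<dots> = ?h powr (- \<epsilon>) * ((\<Sum>k\<le>m. ?u k) + (\<Sum>k\<le>m. ?u (m - k)))"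
      by (simp only: sum_distrib_left[symmetric] sum.distrib)
    also have "(\<Sum>k\<le>m. ?u (m - k)) = (\<Sum>k\<le>m. ?u k)"
      by (rule sum.reindex_bij_witness[of _ "\<lambda>k. m - k" "\<lambda>k. m - k"]) auto
    also have "?h powr (- \<epsilon>) * ((\<Sum>k\<le>m. ?u k) + (\<Sum>k\<le>m. ?u k)) \<le> ?h powr (- \<epsilon>) * (S + S)"
      by (intro mult_left_mono add_mono S) auto
    finally show ?thesis by (simp add: mult_ac)
  qed
  have "(\<lambda>m. 2 * S * (real (m + 2) / 2) powr (- \<epsilon>)) \<longlonglongrightarrow> 0"
    using eps by real_asymp
  then show ?thesis
    by (rule Lim_null_comparison[rotated])
      (intro always_eventually allI, use bound in \<open>simp add: sum_nonneg\<close>)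
qed

section \<open>Almost surely convergent series of random variables\<close>

text \<open>
  Near zero the characteristic function of a centred distribution with second moment \<open>v\<close> is \<open>1 - v t\<^sup>2/2 + o(t\<^sup>2)\<close>. The error is at most
  \<open>t\<^sup>2/6\<close> times a truncated moment that tends to zero, so eventually less than \<open>v t\<^sup>2/6\<close>; this is how
  \<open>1/2\<close> becomes \<open>1/3\<close>.
\<close>

lemma (in real_distribution) eventually_char_le_exp:
  assumes int: "integrable M (\<lambda>x. x)" "expectation (\<lambda>x. x) = 0"
    and int2: "integrable M (\<lambda>x. x\<^sup>2)" "expectation (\<lambda>x. x\<^sup>2) = v"
    and v: "v > 0" and t: "t \<longlonglongrightarrow> (0::real)"
  shows "\<forall>\<^sub>F k in sequentially. cmod (char M (t k)) \<le> exp (- (v / 3) * (t k)\<^sup>2)"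
proof -
  let ?err = "\<lambda>k. expectation (\<lambda>x. min (6 * x\<^sup>2) (\<bar>t k\<bar> * \<bar>x\<bar> ^ 3))"
  have "?err \<longlonglongrightarrow> expectation (\<lambda>x. 0)"
  proof (rule integral_dominated_convergence[where w = "\<lambda>x. 6 * x\<^sup>2"])
    show "AE x in M. (\<lambda>k. min (6 * x\<^sup>2) (\<bar>t k\<bar> * \<bar>x\<bar> ^ 3)) \<longlonglongrightarrow> 0"
    proof (rule AE_I2)
      fix x :: real
      have "(\<lambda>k. min (6 * x\<^sup>2) (\<bar>t k\<bar> * \<bar>x\<bar> ^ 3)) \<longlonglongrightarrow> min (6 * x\<^sup>2) (\<bar>0\<bar> * \<bar>x\<bar> ^ 3)"
        by (intro tendsto_intros t)
      then show "(\<lambda>k. min (6 * x\<^sup>2) (\<bar>t k\<bar> * \<bar>x\<bar> ^ 3)) \<longlonglongrightarrow> 0" by simp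
    qed
  qed (use int2 in auto)
  then have "?err \<longlonglongrightarrow> 0" by simp
  from order_tendstoD(2)[OF this v] have "\<forall>\<^sub>F k in sequentially. ?err k < v" .
  moreover have "(\<lambda>k. (t k)\<^sup>2 * v / 2) \<longlonglongrightarrow> 0\<^sup>2 * v / 2" by (intro tendsto_intros t) auto
  then have "\<forall>\<^sub>F k in sequentially. (t k)\<^sup>2 * v / 2 < 1" by (rule order_tendstoD) simp
  ultimately show ?thesis
  proof eventually_elim
    case (elim k)
    have "variance (\<lambda>x. x) = v" using int(2) int2(2) by simp
    from char_approx3[OF int int2(1) this, of "t k"]
    have "cmod (char M (t k) - (1 - (t k)\<^sup>2 * v / 2)) \<le> (t k)\<^sup>2 / 6 * ?err k" .
    also have "\<dots> \<le> (t k)\<^sup>2 / 6 * v" using elim by (intro mult_left_mono) auto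
    finally have "cmod (char M (t k) - (1 - (t k)\<^sup>2 * v / 2)) \<le> (t k)\<^sup>2 / 6 * v" .
    moreover have "cmod (char M (t k)) \<le>
        cmod (char M (t k) - (1 - (t k)\<^sup>2 * v / 2)) + cmod (complex_of_real (1 - (t k)\<^sup>2 * v / 2))"
      using norm_triangle_sub[of "char M (t k)" "complex_of_real (1 - (t k)\<^sup>2 * v / 2)"] by simp
    moreover have "cmod (complex_of_real (1 - (t k)\<^sup>2 * v / 2)) = 1 - (t k)\<^sup>2 * v / 2"
      unfolding norm_of_real using elim by simp
    ultimately have "cmod (char M (t k)) \<le> 1 + (- (v / 3) * (t k)\<^sup>2)" by (simp add: field_simps)
    also have "\<dots> \<le> exp (- (v / 3) * (t k)\<^sup>2)" by (rule exp_ge_add_one_self)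
    finally show ?case .
  qed
qed

context prob_space begin

lemma orthogonal_sum_second_moment:
  fixes W :: "'i \<Rightarrow> 'a \<Rightarrow> real"
  assumes int: "\<And>i j. integrable M (\<lambda>x. W i x * W j x)"
    and orth: "\<And>i j. expectation (\<lambda>x. W i x * W j x) = (if i = j then v else 0)"
    and fin: "finite I"
  shows "integrable M (\<lambda>x. (\<Sum>i\<in>I. c i * W i x)\<^sup>2)" (is ?int)
    and "expectation (\<lambda>x. (\<Sum>i\<in>I. c i * W i x)\<^sup>2) = v * (\<Sum>i\<in>I. (c i)\<^sup>2)" (is ?eq)
proof -
  have eq: "(\<Sum>i\<in>I. c i * W i x)\<^sup>2 = (\<Sum>i\<in>I. \<Sum>j\<in>I. (c i * c j) * (W i x * W j x))" for x
    by (simp add: power2_eq_square sum_product mult_ac)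
  show ?int unfolding eq by (intro Bochner_Integration.integrable_sum integrable_mult_right int)
  have "expectation (\<lambda>x. (\<Sum>i\<in>I. c i * W i x)\<^sup>2) =
      (\<Sum>i\<in>I. \<Sum>j\<in>I. (c i * c j) * (if i = j then v else 0))"
    unfolding eq by (simp add: int orth)
  also have "\<dots> = v * (\<Sum>i\<in>I. (c i)\<^sup>2)"
    using fin by (simp add: sum_distrib_left power2_eq_square mult_ac if_distrib sum.delta cong: if_cong)
  finally show ?eq .
qed

lemma orthogonal_sum_nn_integral:
  fixes W :: "'i \<Rightarrow> 'a \<Rightarrow> real"
  assumes int: "\<And>i j. integrable M (\<lambda>x. W i x * W j x)"
    and orth: "\<And>i j. expectation (\<lambda>x. W i x * W j x) = (if i = j then v else 0)"
    and fin: "finite I"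
  shows "(\<integral>\<^sup>+x. ennreal ((\<Sum>i\<in>I. c i * W i x)\<^sup>2) \<partial>M) = ennreal (v * (\<Sum>i\<in>I. (c i)\<^sup>2))"
  using orthogonal_sum_second_moment[OF assms, of c]
  by (subst nn_integral_eq_integral) auto

text \<open>
  Fatou's lemma applied to the partial sums. The almost sure limit \<open>U\<close> is thereby also controlled in
  \<open>L\<^sup>2\<close>, without identifying it beforehand with the \<open>L\<^sup>2\<close> limit.
\<close>

lemma orthogonal_series_tail_bound:
  fixes W :: "nat \<Rightarrow> 'a \<Rightarrow> real"
  assumes [measurable]: "\<And>i. W i \<in> borel_measurable M" "U \<in> borel_measurable M"
    and int: "\<And>i j. integrable M (\<lambda>x. W i x * W j x)"
    and orth: "\<And>i j. expectation (\<lambda>x. W i x * W j x) = (if i = j then v else 0)"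
    and v: "v \<ge> 0"
    and sums: "AE x in M. (\<lambda>k. c k * W k x) sums U x"
    and tail: "\<And>m. N \<le> m \<Longrightarrow> (\<Sum>j\<in>{N<..m}. (c j)\<^sup>2) \<le> B"
  shows "(\<integral>\<^sup>+x. ennreal ((U x - (\<Sum>j\<le>N. c j * W j x))\<^sup>2) \<partial>M) \<le> ennreal (v * B)"
proof -
  let ?F = "\<lambda>m x. ennreal ((\<Sum>j\<in>{N<..m}. c j * W j x)\<^sup>2)"
  have "AE x in M. ennreal ((U x - (\<Sum>j\<le>N. c j * W j x))\<^sup>2) = liminf (\<lambda>m. ?F m x)"
    using sums
  proof eventually_elim
    case (elim x)
    have "(\<lambda>m. \<Sum>j\<le>m. c j * W j x) \<longlonglongrightarrow> U x"
      using elim by (simp add: sums_def_le)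
    then have "(\<lambda>m. ennreal (((\<Sum>j\<le>m. c j * W j x) - (\<Sum>j\<le>N. c j * W j x))\<^sup>2))
        \<longlonglongrightarrow> ennreal ((U x - (\<Sum>j\<le>N. c j * W j x))\<^sup>2)"
      by (intro tendsto_intros)
    then have "(\<lambda>m. ?F m x) \<longlonglongrightarrow> ennreal ((U x - (\<Sum>j\<le>N. c j * W j x))\<^sup>2)"
    proof (rule Lim_transform_eventually)
      show "\<forall>\<^sub>F m in sequentially.
          ennreal (((\<Sum>j\<le>m. c j * W j x) - (\<Sum>j\<le>N. c j * W j x))\<^sup>2) = ?F m x"
        using eventually_ge_at_top[of N]
      proof eventually_elim
        case (elim m)
        have "{..m} = {..N} \<union> {N<..m}" "{..N} \<inter> {N<..m} = {}" using elim by auto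
        then show ?case by (simp add: sum.union_disjoint)
      qed
    qed
    from lim_imp_Liminf[OF _ this] show ?case by simp
  qed
  then have "(\<integral>\<^sup>+x. ennreal ((U x - (\<Sum>j\<le>N. c j * W j x))\<^sup>2) \<partial>M) =
      (\<integral>\<^sup>+x. liminf (\<lambda>m. ?F m x) \<partial>M)"
    by (rule nn_integral_cong_AE)
  also have "\<dots> \<le> liminf (\<lambda>m. \<integral>\<^sup>+x. ?F m x \<partial>M)"
    by (rule nn_integral_liminf) measurable
  also have "\<dots> \<le> liminf (\<lambda>m. ennreal (v * B))"
  proof (rule Liminf_mono)
    show "\<forall>\<^sub>F m in sequentially. (\<integral>\<^sup>+x. ?F m x \<partial>M) \<le> ennreal (v * B)"
      using eventually_ge_at_top[of N]
    proof eventually_elim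
      case (elim m)
      have "(\<integral>\<^sup>+x. ?F m x \<partial>M) = ennreal (v * (\<Sum>i\<in>{N<..m}. (c i)\<^sup>2))"
        by (rule orthogonal_sum_nn_integral[OF int orth]) simp
      also have "\<dots> \<le> ennreal (v * B)"
        using v tail[OF elim] by (intro ennreal_leI mult_left_mono)
      finally show ?case .
    qed
  qed
  also have "\<dots> = ennreal (v * B)" by (simp add: Liminf_const)
  finally show ?thesis .
qed

text \<open>
  A partial sum has second moment at least \<open>v c\<^sub>0\<^sup>2\<close>, and by the tail bound \<open>U\<close> differs little from a late
  one. The constant \<open>1/4\<close> is what the inequality \<open>S\<^sup>2 \<le> 2 U\<^sup>2 + 2 (U - S)\<^sup>2\<close> leaves when the tail is below
  \<open>c\<^sub>0\<^sup>2/4\<close>.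
\<close>

lemma orthogonal_series_lower_bound:
  fixes W :: "nat \<Rightarrow> 'a \<Rightarrow> real"
  assumes [measurable]: "\<And>i. W i \<in> borel_measurable M" "U \<in> borel_measurable M"
    and int: "\<And>i j. integrable M (\<lambda>x. W i x * W j x)"
    and orth: "\<And>i j. expectation (\<lambda>x. W i x * W j x) = (if i = j then v else 0)"
    and v: "v \<ge> 0"
    and sums: "AE x in M. (\<lambda>k. c k * W k x) sums U x"
    and sq: "summable (\<lambda>k. (c k)\<^sup>2)"
  shows "ennreal (v * (c 0)\<^sup>2 / 4) \<le> (\<integral>\<^sup>+x. ennreal ((U x)\<^sup>2) \<partial>M)"
proof (cases "c 0 = 0 \<or> (\<integral>\<^sup>+x. ennreal ((U x)\<^sup>2) \<partial>M) = \<infinity>")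
  case False
  let ?B = "(c 0)\<^sup>2 / 4"
  have "?B > 0" using False by simp
  then obtain N where N: "\<And>m n. m \<ge> N \<Longrightarrow> norm (\<Sum>j\<in>{m..<n}. (c j)\<^sup>2) < ?B"
    using sq unfolding summable_Cauchy by blast
  have tail: "(\<Sum>j\<in>{N<..m}. (c j)\<^sup>2) \<le> ?B" for m
    using N[of "Suc N" "Suc m"] by (simp add: atLeastLessThanSuc_atLeastAtMost atLeastSucAtMost_greaterThanAtMost)
  obtain r where r: "(\<integral>\<^sup>+x. ennreal ((U x)\<^sup>2) \<partial>M) = ennreal r" "r \<ge> 0"
    using False by (cases "\<integral>\<^sup>+x. ennreal ((U x)\<^sup>2) \<partial>M") auto
  have "ennreal (v * (c 0)\<^sup>2) \<le> ennreal (v * (\<Sum>j\<le>N. (c j)\<^sup>2))"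
    using v by (intro ennreal_leI mult_left_mono member_le_sum[where f = "\<lambda>j. (c j)\<^sup>2"]) auto
  also have "\<dots> = (\<integral>\<^sup>+x. ennreal ((\<Sum>j\<le>N. c j * W j x)\<^sup>2) \<partial>M)"
    by (rule orthogonal_sum_nn_integral[OF int orth, symmetric]) simp
  also have "\<dots> \<le> (\<integral>\<^sup>+x. ennreal 2 * ennreal ((U x)\<^sup>2) +
      ennreal 2 * ennreal ((U x - (\<Sum>j\<le>N. c j * W j x))\<^sup>2) \<partial>M)"
  proof (rule nn_integral_mono)
    fix x
    let ?S = "\<Sum>j\<le>N. c j * W j x"
    have "?S\<^sup>2 \<le> 2 * (U x)\<^sup>2 + 2 * (U x - ?S)\<^sup>2"
      using zero_le_power2[of "2 * U x - ?S"] by (simp add: power2_eq_square algebra_simps)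
    then show "ennreal (?S\<^sup>2) \<le> ennreal 2 * ennreal ((U x)\<^sup>2) + ennreal 2 * ennreal ((U x - ?S)\<^sup>2)"
      by (simp flip: ennreal_mult ennreal_plus add: ennreal_leI del: ennreal_numeral)
  qed
  also have "\<dots> = ennreal 2 * (\<integral>\<^sup>+x. ennreal ((U x)\<^sup>2) \<partial>M) +
      ennreal 2 * (\<integral>\<^sup>+x. ennreal ((U x - (\<Sum>j\<le>N. c j * W j x))\<^sup>2) \<partial>M)"
    by (simp add: nn_integral_add nn_integral_cmult del: ennreal_numeral)
  also have "\<dots> \<le> ennreal 2 * ennreal r + ennreal 2 * ennreal (v * ?B)"
    unfolding r(1)
    by (intro add_mono mult_left_mono order_refl
        orthogonal_series_tail_bound[OF _ _ int orth v sums tail]) auto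
  also have "\<dots> = ennreal (2 * r + 2 * (v * ?B))"
    using r v by (simp flip: ennreal_mult ennreal_plus del: ennreal_numeral)
  finally have "v * (c 0)\<^sup>2 \<le> 2 * r + 2 * (v * ?B)"
    using r v by (subst (asm) ennreal_le_iff) auto
  then show ?thesis unfolding r(1) by (intro ennreal_leI) simp
qed auto

text \<open>
  The truncated moments \<open>t(r) = E min(1, (r W)\<^sup>2)\<close> grow with \<open>|r|\<close> and are positive for \<open>r \<noteq> 0\<close>, while
  \<open>t(c\<^sub>k) \<rightarrow> 0\<close> by dominated convergence.
\<close>

lemma coefficients_null_if_AE_terms_null:
  fixes W :: "nat \<Rightarrow> 'a \<Rightarrow> real"
  assumes [measurable]: "\<And>i. W i \<in> borel_measurable M"
    and ident: "\<And>i. distr M borel (W i) = distr M borel (W 0)"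
    and nondegenerate: "\<not> (AE x in M. W 0 x = 0)"
    and null: "AE x in M. (\<lambda>k. c k * W k x) \<longlonglongrightarrow> 0"
  shows "c \<longlonglongrightarrow> 0"
proof (rule ccontr)
  define t where "t r = expectation (\<lambda>x. min 1 ((r * W 0 x)\<^sup>2))" for r :: real
  have int: "integrable M (\<lambda>x. min 1 ((r * W i x)\<^sup>2))" for r i
    by (rule integrable_const_bound[of _ 1]) auto
  have t: "expectation (\<lambda>x. min 1 ((r * W i x)\<^sup>2)) = t r" for r i
    using integral_distr[of "W i" M borel "\<lambda>w. min 1 ((r * w)\<^sup>2)"]
      integral_distr[of "W 0" M borel "\<lambda>w. min 1 ((r * w)\<^sup>2)"]
    by (simp add: t_def ident[of i])
  have "(\<lambda>k. expectation (\<lambda>x. min 1 ((c k * W k x)\<^sup>2))) \<longlonglongrightarrow> expectation (\<lambda>x. 0)"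
  proof (rule integral_dominated_convergence[where w = "\<lambda>_. 1"])
    show "AE x in M. (\<lambda>k. min 1 ((c k * W k x)\<^sup>2)) \<longlonglongrightarrow> 0"
      using null
    proof eventually_elim
      case (elim x)
      from tendsto_min[OF tendsto_const[of "1::real"] tendsto_power[OF elim, of 2]]
      show ?case by simp
    qed
  qed auto
  then have lim: "(\<lambda>k. t (c k)) \<longlonglongrightarrow> 0" by (simp add: t)
  assume "\<not> c \<longlonglongrightarrow> 0"
  then obtain \<eta> where \<eta>: "\<eta> > 0" and freq: "\<exists>\<^sub>F k in sequentially. \<bar>c k\<bar> \<ge> \<eta>"
    unfolding tendsto_iff frequently_def by (auto simp: not_le)
  have "t \<eta> \<noteq> 0"
  proof
    assume "t \<eta> = 0"
    then have "AE x in M. min 1 ((\<eta> * W 0 x)\<^sup>2) = 0"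
      unfolding t_def by (subst (asm) integral_nonneg_eq_0_iff_AE[OF int]) auto
    then have "AE x in M. W 0 x = 0"
      by eventually_elim (use \<eta> in \<open>auto simp: min_def split: if_splits\<close>)
    with nondegenerate show False by blast
  qed
  moreover have "t \<eta> \<ge> 0" unfolding t_def by (intro integral_nonneg_AE) auto
  ultimately have "\<forall>\<^sub>F k in sequentially. t (c k) < t \<eta>"
    using order_tendstoD(2)[OF lim] by simp
  moreover have "t \<eta> \<le> t (c k)" if "\<bar>c k\<bar> \<ge> \<eta>" for k
    unfolding t_def
  proof (rule integral_mono[OF int int])
    fix x
    have "(\<eta> * W 0 x)\<^sup>2 \<le> (c k * W 0 x)\<^sup>2"
      unfolding power_mult_distrib using that \<eta>
      by (intro mult_right_mono) (auto simp flip: abs_le_square_iff)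
    then show "min 1 ((\<eta> * W 0 x)\<^sup>2) \<le> min 1 ((c k * W 0 x)\<^sup>2)" by (auto simp: min_def)
  qed
  ultimately have "\<forall>\<^sub>F k in sequentially. \<not> \<bar>c k\<bar> \<ge> \<eta>"
    by (auto elim!: eventually_mono) (meson not_le)
  with freq show False by (simp add: frequently_def)
qed

text \<open>
  The characteristic functions \<open>\<Prod>\<^bsub>k<n\<^esub> \<phi>(u c\<^sub>k)\<close> of the partial sums converge to that of the limit, which is
  continuous with value one at zero; so for some \<open>u \<noteq> 0\<close> the products stay away from zero. As
  \<open>c\<^sub>k \<rightarrow> 0\<close>, the factors are eventually at most \<open>exp(- v u\<^sup>2 c\<^sub>k\<^sup>2 / 3)\<close>, which bounds
  \<open>\<Sum> c\<^sub>k\<^sup>2\<close>.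
\<close>

lemma square_summable_if_AE_summable:
  fixes W :: "nat \<Rightarrow> 'a \<Rightarrow> real"
  assumes indep: "indep_vars (\<lambda>_. borel) W UNIV"
    and ident: "\<And>i. distr M borel (W i) = distr M borel (W 0)"
    and int: "integrable M (W 0)" "expectation (W 0) = 0"
    and int2: "integrable M (\<lambda>x. (W 0 x)\<^sup>2)" "expectation (\<lambda>x. (W 0 x)\<^sup>2) = v"
    and v: "v > 0"
    and summable: "AE x in M. summable (\<lambda>k. c k * W k x)"
  shows "summable (\<lambda>k. (c k)\<^sup>2)"
proof -
  have W [measurable]: "W i \<in> borel_measurable M" for i
    using indep unfolding indep_vars_def2 by simp
  have nondegenerate: "\<not> (AE x in M. W 0 x = 0)"
  proof
    assume "AE x in M. W 0 x = 0"
    then have "expectation (\<lambda>x. (W 0 x)\<^sup>2) = expectation (\<lambda>x. 0)"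
      by (intro integral_cong_AE) auto
    with int2 v show False by simp
  qed
  have c0: "c \<longlonglongrightarrow> 0"
  proof (rule coefficients_null_if_AE_terms_null[where W = W])
    show "AE x in M. (\<lambda>k. c k * W k x) \<longlonglongrightarrow> 0"
      using summable by eventually_elim (rule summable_LIMSEQ_zero)
  qed (fact W ident nondegenerate)+
  define \<mu> where "\<mu> = distr M borel (W 0)"
  interpret \<mu>: real_distribution \<mu> unfolding \<mu>_def by simp
  define S where "S x = (\<Sum>k. c k * W k x)" for x
  have S [measurable]: "S \<in> borel_measurable M" unfolding S_def by measurable
  interpret S: real_distribution "distr M borel S" by simp
  have partial: "char (distr M borel (\<lambda>x. \<Sum>k<n. c k * W k x)) u = (\<Prod>k<n. char \<mu> (u * c k))" for n u
  proof -
    have "indep_vars (\<lambda>_. borel) (\<lambda>k x. c k * W k x) {..<n}"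
      by (rule indep_vars_compose2[OF indep_vars_subset[OF indep]]) auto
    moreover have "char (distr M borel (\<lambda>x. c k * W k x)) u = char \<mu> (u * c k)" for k
      unfolding \<mu>_def ident[of k, symmetric] char_def by (simp add: integral_distr mult_ac)
    ultimately show ?thesis by (simp add: char_distr_sum)
  qed
  have lim: "(\<lambda>n. \<Prod>k<n. char \<mu> (u * c k)) \<longlonglongrightarrow> char (distr M borel S) u" for u
  proof -
    have "(\<lambda>n. expectation (\<lambda>x. iexp (u * (\<Sum>k<n. c k * W k x)))) \<longlonglongrightarrow> expectation (\<lambda>x. iexp (u * S x))"
    proof (rule integral_dominated_convergence[where w = "\<lambda>_. 1"])
      show "AE x in M. (\<lambda>n. iexp (u * (\<Sum>k<n. c k * W k x))) \<longlonglongrightarrow> iexp (u * S x)"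
        using summable
      proof eventually_elim
        case (elim x)
        then have "(\<lambda>n. \<Sum>k<n. c k * W k x) \<longlonglongrightarrow> S x"
          unfolding S_def by (rule summable_LIMSEQ)
        then show ?case by (intro tendsto_intros)
      qed
    qed auto
    moreover have "expectation (\<lambda>x. iexp (u * (\<Sum>k<n. c k * W k x))) =
        char (distr M borel (\<lambda>x. \<Sum>k<n. c k * W k x)) u" for n
      unfolding char_def by (subst integral_distr) auto
    moreover have "expectation (\<lambda>x. iexp (u * S x)) = char (distr M borel S) u"
      unfolding char_def by (subst integral_distr) auto
    ultimately show ?thesis by (simp only: partial)
  qed
  obtain u where u: "u \<noteq> 0" "cmod (char (distr M borel S) u) > 1/2"
  proof -
    have "((\<lambda>u. cmod (char (distr M borel S) u)) \<longlongrightarrow> cmod (char (distr M borel S) 0)) (at 0)"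
      using S.isCont_char[of 0] by (intro tendsto_norm) (simp add: isCont_def)
    then have "\<forall>\<^sub>F u in at 0. cmod (char (distr M borel S) u) > 1/2"
      by (rule order_tendstoD) (simp add: S.char_zero)
    moreover have "\<forall>\<^sub>F u in at (0::real). u \<noteq> 0" by (simp add: eventually_at_filter)
    ultimately have "\<forall>\<^sub>F u in at (0::real). u \<noteq> 0 \<and> cmod (char (distr M borel S) u) > 1/2"
      by eventually_elim simp
    then have "\<exists>u::real. u \<noteq> 0 \<and> cmod (char (distr M borel S) u) > 1/2"
      by (rule eventually_happens'[rotated]) simp
    with that show thesis by blast
  qed
  have "\<forall>\<^sub>F k in sequentially. cmod (char \<mu> (u * c k)) \<le> exp (- (v / 3) * (u * c k)\<^sup>2)"
  proof (rule \<mu>.eventually_char_le_exp)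
    show "(\<lambda>k. u * c k) \<longlonglongrightarrow> 0" using tendsto_mult_left[OF c0, of u] by simp
  qed (use int int2 v in \<open>simp_all add: \<mu>_def integrable_distr_eq integral_distr\<close>)
  then obtain K where K: "\<And>k. k \<ge> K \<Longrightarrow> cmod (char \<mu> (u * c k)) \<le> exp (- (v / 3) * (u * c k)\<^sup>2)"
    unfolding eventually_sequentially by blast
  have prod_le: "cmod (\<Prod>k<K + n. char \<mu> (u * c k)) \<le> exp (- (v / 3) * u\<^sup>2 * (\<Sum>k<n. (c (k + K))\<^sup>2))" for n
  proof (induction n)
    case 0
    show ?case by (simp add: prod_norm[symmetric] \<mu>.cmod_char_le_1 prod_le_1)
  next
    case (Suc n)
    have "cmod (\<Prod>k<K + Suc n. char \<mu> (u * c k)) =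
        cmod (\<Prod>k<K + n. char \<mu> (u * c k)) * cmod (char \<mu> (u * c (K + n)))"
      by (simp add: norm_mult)
    also have "\<dots> \<le> exp (- (v / 3) * u\<^sup>2 * (\<Sum>k<n. (c (k + K))\<^sup>2)) * exp (- (v / 3) * (u * c (K + n))\<^sup>2)"
      by (intro mult_mono Suc K) auto
    also have "\<dots> = exp (- (v / 3) * u\<^sup>2 * (\<Sum>k<Suc n. (c (k + K))\<^sup>2))"
      by (simp add: exp_add[symmetric] algebra_simps power_mult_distrib)
    finally show ?case .
  qed
  have "(\<lambda>n. cmod (\<Prod>k<K + n. char \<mu> (u * c k))) \<longlonglongrightarrow> cmod (char (distr M borel S) u)"
    using LIMSEQ_ignore_initial_segment[OF tendsto_norm[OF lim[of u]], of K] by (simp add: add.commute)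
  from order_tendstoD(1)[OF this u(2)]
  have ev: "\<forall>\<^sub>F n in sequentially. cmod (\<Prod>k<K + n. char \<mu> (u * c k)) > 1/2" .
  have "(\<Sum>k<n. (c (k + K))\<^sup>2) \<le> 3 * ln 2 / (v * u\<^sup>2)" for n
  proof -
    obtain m where m: "m \<ge> n" "cmod (\<Prod>k<K + m. char \<mu> (u * c k)) > 1/2"
      using ev unfolding eventually_sequentially by (meson linorder_linear)
    let ?s = "\<Sum>k<m. (c (k + K))\<^sup>2"
    have "1/2 < exp (- (v / 3) * u\<^sup>2 * ?s)" using m(2) prod_le[of m] by linarith
    then have "ln (1/2) < ln (exp (- (v / 3) * u\<^sup>2 * ?s))"
      by (subst ln_less_cancel_iff) auto
    then have "v * u\<^sup>2 * ?s \<le> 3 * ln 2" by (simp add: ln_div)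
    then have "?s \<le> 3 * ln 2 / (v * u\<^sup>2)"
      using v u(1) by (simp add: field_simps)
    moreover have "(\<Sum>k<n. (c (k + K))\<^sup>2) \<le> ?s" using m(1) by (intro sum_mono2) auto
    ultimately show ?thesis by simp
  qed
  then have "summable (\<lambda>k. (c (k + K))\<^sup>2)"
    by (intro summableI_nonneg_bounded) auto
  then show ?thesis by (subst (asm) summable_iff_shift)
qed

end

lemma (in prob_space) indep_vars_reindex_inj:
  assumes indep: "indep_vars (\<lambda>_. N) X UNIV" and f: "inj f"
  shows "indep_vars (\<lambda>_. N) (\<lambda>i. X (f i)) UNIV"
  unfolding indep_vars_def2
proof (intro conjI ballI indep_setsI)
  show "random_variable N (X (f i))" for i using indep unfolding indep_vars_def2 by simp
  then show "{X (f i) -` A \<inter> space M |A. A \<in> sets N} \<subseteq> events" for i by auto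
  fix A J
  assume J: "J \<noteq> {}" "finite J" and A: "\<forall>j\<in>J. A j \<in> {X (f j) -` B \<inter> space M |B. B \<in> sets N}"
  have inv: "inv f (f j) = j" for j using f by simp
  have "prob (\<Inter>j\<in>f ` J. A (inv f j)) = (\<Prod>j\<in>f ` J. prob (A (inv f j)))"
  proof (rule indep_setsD)
    show "indep_sets (\<lambda>i. {X i -` B \<inter> space M |B. B \<in> sets N}) UNIV"
      using indep unfolding indep_vars_def2 by simp
    show "\<forall>j\<in>f ` J. A (inv f j) \<in> {X j -` B \<inter> space M |B. B \<in> sets N}"
      using A by (auto simp only: inv ball_simps)
  qed (use J in auto)
  then show "prob (\<Inter>j\<in>J. A j) = (\<Prod>j\<in>J. prob (A j))"
    by (simp add: inv prod.reindex inj_on_subset[OF f])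
qed

text \<open>
  Apart from the factor 2 this is Jensen's inequality. It comes from splitting at \<open>U\<^sup>2 = e\<close>: below,
  \<open>|U|\<^sup>r \<le> e\<^bsup>r/2\<^esup>\<close>; above, \<open>|U|\<^sup>r = U\<^sup>2 (U\<^sup>2)\<^bsup>r/2-1\<^esup> \<le> U\<^sup>2 e\<^bsup>r/2-1\<^esup>\<close>, since \<open>r \<le> 2\<close>.
\<close>

lemma (in prob_space) absolute_moment_bound_of_second_moment:
  assumes [measurable]: "U \<in> borel_measurable M"
    and e: "0 < e" "(\<integral>\<^sup>+x. ennreal ((U x)\<^sup>2) \<partial>M) \<le> ennreal e"
    and r: "0 < r" "r \<le> 2"
  shows "(\<integral>\<^sup>+x. ennreal (\<bar>U x\<bar> powr r) \<partial>M) \<le> ennreal (2 * e powr (r / 2))"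
proof -
  have "(\<integral>\<^sup>+x. ennreal (\<bar>U x\<bar> powr r) \<partial>M) \<le>
      (\<integral>\<^sup>+x. ennreal (e powr (r / 2)) + ennreal (e powr (r / 2 - 1)) * ennreal ((U x)\<^sup>2) \<partial>M)"
  proof (rule nn_integral_mono)
    fix x
    have square_powr: "((U x)\<^sup>2) powr y = \<bar>U x\<bar> powr (2 * y)" for y
      using powr_powr[of "\<bar>U x\<bar>" 2 y] by simp
    have "\<bar>U x\<bar> powr r \<le> e powr (r / 2) + e powr (r / 2 - 1) * (U x)\<^sup>2"
    proof (cases "(U x)\<^sup>2 \<le> e")
      case True
      have "\<bar>U x\<bar> powr r = ((U x)\<^sup>2) powr (r / 2)" by (simp add: square_powr)
      also have "\<dots> \<le> e powr (r / 2)" using True r by (intro powr_mono2) auto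
      finally show ?thesis using e by (simp add: add_increasing2)
    next
      case False
      then have "U x \<noteq> 0" using e by auto
      have "\<bar>U x\<bar> powr r = ((U x)\<^sup>2) powr (r / 2 - 1 + 1)"
        by (simp add: square_powr)
      also have "\<dots> = ((U x)\<^sup>2) powr (r / 2 - 1) * (U x)\<^sup>2"
        using \<open>U x \<noteq> 0\<close> by (subst powr_add) simp
      also have "\<dots> \<le> e powr (r / 2 - 1) * (U x)\<^sup>2"
        using False e r by (intro mult_right_mono powr_mono2') auto
      finally show ?thesis by (simp add: add_increasing)
    qed
    then show "ennreal (\<bar>U x\<bar> powr r) \<le>
        ennreal (e powr (r / 2)) + ennreal (e powr (r / 2 - 1)) * ennreal ((U x)\<^sup>2)"
      by (simp flip: ennreal_mult ennreal_plus add: ennreal_leI)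
  qed
  also have "\<dots> = ennreal (e powr (r / 2)) +
      ennreal (e powr (r / 2 - 1)) * (\<integral>\<^sup>+x. ennreal ((U x)\<^sup>2) \<partial>M)"
    by (simp add: nn_integral_add nn_integral_cmult emeasure_space_1)
  also have "\<dots> \<le> ennreal (e powr (r / 2)) + ennreal (e powr (r / 2 - 1)) * ennreal e"
    by (intro add_left_mono mult_left_mono e) auto
  also have "\<dots> = ennreal (e powr (r / 2) + e powr (r / 2 - 1) * e)"
    using e by (simp flip: ennreal_mult ennreal_plus)
  also have "e powr (r / 2) + e powr (r / 2 - 1) * e = 2 * e powr (r / 2)"
    using e(1) by (simp add: powr_diff)
  finally show ?thesis .
qed

section \<open>Inversion of causal linear processes\<close>

text \<open>
  The index shift by one in \<open>Y_sums\<close> is that of the log-volatility, which depends on the strict past.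
\<close>

locale causal_linear_process = prob_space M for M :: "'a measure" +
  fixes W Y :: "int \<Rightarrow> 'a \<Rightarrow> real" and c :: "nat \<Rightarrow> real" and v :: real
  assumes W_measurable [measurable]: "\<And>t. W t \<in> borel_measurable M"
    and Y_measurable [measurable]: "\<And>t. Y t \<in> borel_measurable M"
    and W_integrable_mult: "\<And>t u. integrable M (\<lambda>x. W t x * W u x)"
    and W_orthogonal: "\<And>t u. expectation (\<lambda>x. W t x * W u x) = (if t = u then v else 0)"
    and v_nonneg: "v \<ge> 0"
    and Y_sums: "\<And>t. AE x in M. (\<lambda>k. c k * W (t - 1 - int k) x) sums Y t x"
begin

lemma tail_bound:
  assumes "\<And>m. N \<le> m \<Longrightarrow> (\<Sum>j\<in>{N<..m}. (c j)\<^sup>2) \<le> B"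
  shows "(\<integral>\<^sup>+x. ennreal ((Y t x - (\<Sum>j\<le>N. c j * W (t - 1 - int j) x))\<^sup>2) \<partial>M) \<le> ennreal (v * B)"
proof (rule orthogonal_series_tail_bound[where W = "\<lambda>k. W (t - 1 - int k)"])
  show "expectation (\<lambda>x. W (t - 1 - int i) x * W (t - 1 - int j) x) = (if i = j then v else 0)" for i j
    by (simp add: W_orthogonal)
qed (use assms W_integrable_mult v_nonneg Y_sums in simp_all)

lemma second_moment_lower_bound:
  assumes "summable (\<lambda>k. (c k)\<^sup>2)"
  shows "ennreal (v * (c 0)\<^sup>2 / 4) \<le> (\<integral>\<^sup>+x. ennreal ((Y t x)\<^sup>2) \<partial>M)"
proof (rule orthogonal_series_lower_bound[where W = "\<lambda>k. W (t - 1 - int k)"])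
  show "expectation (\<lambda>x. W (t - 1 - int i) x * W (t - 1 - int j) x) = (if i = j then v else 0)" for i j
    by (simp add: W_orthogonal)
qed (use assms W_integrable_mult v_nonneg Y_sums in simp_all)

text \<open>
  The terms with \<open>k + j = n\<close> carry the same noise variable and the coefficient \<open>(c' * c)\<^sub>n\<close>, which vanishes
  for \<open>n > 0\<close>. The cut-off \<open>m - k\<close> is chosen so that every such diagonal with \<open>n \<le> m\<close> is complete.
\<close>

lemma truncated_inversion:
  assumes inv: "\<And>n. (\<Sum>k\<le>n. c' k * c (n - k)) = (if n = 0 then 1 else 0)"
  shows "(\<Sum>k\<le>m. c' k * (\<Sum>j\<le>m - k. c j * W (t - int k - 1 - int j) x)) = W (t - 1) x"
proof -
  let ?f = "\<lambda>k j. c' k * c j * W (t - 1 - int (k + j)) x"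
  have "(\<Sum>k\<le>m. c' k * (\<Sum>j\<le>m - k. c j * W (t - int k - 1 - int j) x)) = (\<Sum>k\<le>m. \<Sum>j\<le>m - k. ?f k j)"
    by (simp add: sum_distrib_left algebra_simps)
  also have "\<dots> = (\<Sum>(k, j)\<in>(SIGMA k:{..m}. {..m - k}). ?f k j)"
    by (subst sum.Sigma) auto
  also have "(SIGMA k:{..m}. {..m - k}) = {(k, j). k + j \<le> m}" by auto
  also have "(\<Sum>(k, j)\<in>{(k, j). k + j \<le> m}. ?f k j) = (\<Sum>n\<le>m. \<Sum>k\<le>n. ?f k (n - k))"
    by (rule sum.triangle_reindex_eq)
  also have "\<dots> = (\<Sum>n\<le>m. (\<Sum>k\<le>n. c' k * c (n - k)) * W (t - 1 - int n) x)"
    by (intro sum.cong refl) (simp add: sum_distrib_right)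
  also have "\<dots> = W (t - 1) x"
    by (simp add: inv if_distrib[of "\<lambda>y. y * _"] sum.delta cong: if_cong)
  finally show ?thesis .
qed

text \<open>
  The remainders \<open>T\<^sub>k\<close> have \<open>L\<^sup>2\<close> norm at most \<open>\<surd>v r\<^bsub>m-k\<^esub>\<close>, and the claim is the triangle inequality for
  \<open>\<Sum> c'\<^sub>k T\<^sub>k\<close>. It is proved by a pointwise Cauchy--Schwarz inequality with the weights \<open>w\<^sub>k r\<^bsub>m-k\<^esub>\<close>; these
  make the integrated right-hand side the square of the sum of the norm bounds.
\<close>

lemma truncated_inversion_error:
  assumes inv: "\<And>n. (\<Sum>k\<le>n. c' k * c (n - k)) = (if n = 0 then 1 else 0)"
    and w: "\<And>k. 0 < w k" "\<And>k. \<bar>c' k\<bar> \<le> w k"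
    and r: "\<And>N. 0 < r N" "\<And>N m. N \<le> m \<Longrightarrow> (\<Sum>j\<in>{N<..m}. (c j)\<^sup>2) \<le> (r N)\<^sup>2"
  shows "(\<integral>\<^sup>+x. ennreal (((\<Sum>k\<le>m. c' k * Y (t - int k) x) - W (t - 1) x)\<^sup>2) \<partial>M)
           \<le> ennreal (v * (\<Sum>k\<le>m. w k * r (m - k))\<^sup>2)"
proof -
  define T where "T k x = Y (t - int k) x - (\<Sum>j\<le>m - k. c j * W (t - int k - 1 - int j) x)" for k x
  have [measurable]: "T k \<in> borel_measurable M" for k unfolding T_def by measurable
  define A where "A = (\<Sum>k\<le>m. w k * r (m - k))"
  have A: "A \<ge> 0" unfolding A_def using w(1) r(1) by (intro sum_nonneg) (simp add: less_imp_le)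
  have nz: "w k \<noteq> 0" "r k \<noteq> 0" for k using w(1)[of k] r(1)[of k] by auto
  have pos: "0 < w k * r (m - k)" "0 \<le> w k / r (m - k)" for k
    using w(1)[of k] r(1)[of "m - k"] by auto
  have pointwise: "((\<Sum>k\<le>m. c' k * Y (t - int k) x) - W (t - 1) x)\<^sup>2
      \<le> A * (\<Sum>k\<le>m. w k / r (m - k) * (T k x)\<^sup>2)" for x
  proof -
    let ?a = "\<lambda>k. sqrt (w k * r (m - k))"
    have "(\<Sum>k\<le>m. c' k * Y (t - int k) x) - W (t - 1) x = (\<Sum>k\<le>m. c' k * T k x)"
      unfolding T_def truncated_inversion[OF inv, of t x m, symmetric]
      by (simp add: sum_subtractf algebra_simps)
    also have "\<dots> = (\<Sum>k\<le>m. ?a k * (c' k * T k x / ?a k))"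
      using nz by (intro sum.cong refl) simp
    finally have "((\<Sum>k\<le>m. c' k * Y (t - int k) x) - W (t - 1) x)\<^sup>2
        \<le> (\<Sum>k\<le>m. (?a k)\<^sup>2) * (\<Sum>k\<le>m. (c' k * T k x / ?a k)\<^sup>2)"
      by (simp only: Cauchy_Schwarz_ineq_sum)
    also have "(\<Sum>k\<le>m. (?a k)\<^sup>2) = A"
      unfolding A_def using pos(1) by (simp add: less_imp_le)
    also have "A * (\<Sum>k\<le>m. (c' k * T k x / ?a k)\<^sup>2) \<le> A * (\<Sum>k\<le>m. w k / r (m - k) * (T k x)\<^sup>2)"
    proof (intro mult_left_mono sum_mono A)
      fix k
      have "(c' k)\<^sup>2 \<le> (w k)\<^sup>2" using w[of k] by (simp add: abs_le_square_iff[symmetric])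
      then have "(c' k)\<^sup>2 / (w k * r (m - k)) \<le> (w k)\<^sup>2 / (w k * r (m - k))"
        using pos(1)[of k] by (intro divide_right_mono) auto
      also have "\<dots> = w k / r (m - k)" using w(1)[of k] by (simp add: power2_eq_square)
      finally have "(c' k)\<^sup>2 / (w k * r (m - k)) * (T k x)\<^sup>2 \<le> w k / r (m - k) * (T k x)\<^sup>2"
        by (intro mult_right_mono) auto
      then show "(c' k * T k x / ?a k)\<^sup>2 \<le> w k / r (m - k) * (T k x)\<^sup>2"
        using pos(1)[of k] by (simp add: power_divide power_mult_distrib less_imp_le)
    qed
    finally show ?thesis .
  qed
  have ennreal_weighted_sum: "ennreal A * (\<Sum>k\<le>m. ennreal (w k / r (m - k)) * ennreal (y k)) =
      ennreal (A * (\<Sum>k\<le>m. w k / r (m - k) * y k))" if y: "\<And>k. y k \<ge> 0" for y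
  proof -
    have "(\<Sum>k\<le>m. ennreal (w k / r (m - k)) * ennreal (y k)) = ennreal (\<Sum>k\<le>m. w k / r (m - k) * y k)"
      unfolding ennreal_mult[OF pos(2) y, symmetric]
      by (rule sum_ennreal) (intro mult_nonneg_nonneg pos y)
    then show ?thesis
      using A by (simp only: ennreal_mult[OF A sum_nonneg[OF mult_nonneg_nonneg[OF pos(2) y]]])
  qed
  have "(\<integral>\<^sup>+x. ennreal (((\<Sum>k\<le>m. c' k * Y (t - int k) x) - W (t - 1) x)\<^sup>2) \<partial>M)
      \<le> (\<integral>\<^sup>+x. ennreal A * (\<Sum>k\<le>m. ennreal (w k / r (m - k)) * ennreal ((T k x)\<^sup>2)) \<partial>M)"
  proof (rule nn_integral_mono)
    fix x
    show "ennreal (((\<Sum>k\<le>m. c' k * Y (t - int k) x) - W (t - 1) x)\<^sup>2) \<le>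
        ennreal A * (\<Sum>k\<le>m. ennreal (w k / r (m - k)) * ennreal ((T k x)\<^sup>2))"
      unfolding ennreal_weighted_sum[OF zero_le_power2] by (rule ennreal_leI[OF pointwise])
  qed
  also have "\<dots> = ennreal A * (\<Sum>k\<le>m. ennreal (w k / r (m - k)) * (\<integral>\<^sup>+x. ennreal ((T k x)\<^sup>2) \<partial>M))"
    by (simp add: nn_integral_cmult nn_integral_sum)
  also have "\<dots> \<le> ennreal A * (\<Sum>k\<le>m. ennreal (w k / r (m - k)) * ennreal (v * (r (m - k))\<^sup>2))"
    unfolding T_def by (intro mult_left_mono sum_mono tail_bound r(2)) auto
  also have "\<dots> = ennreal (A * (\<Sum>k\<le>m. w k / r (m - k) * (v * (r (m - k))\<^sup>2)))"
    using v_nonneg by (intro ennreal_weighted_sum) simp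
  also have "(\<Sum>k\<le>m. w k / r (m - k) * (v * (r (m - k))\<^sup>2)) = v * A"
    unfolding A_def sum_distrib_left
    by (intro sum.cong refl) (use nz in \<open>simp add: power2_eq_square\<close>)
  finally show ?thesis by (simp add: A_def power2_eq_square mult_ac)
qed

text \<open>
  Consecutive errors differ by \<open>c'\<^bsub>m+1\<^esub> Y\<^bsub>t-m-1\<^esub>\<close>, and the second moments of \<open>Y\<close> are bounded below by the same
  positive constant at all times.
\<close>

lemma inversion_coefficients_null:
  assumes v: "v > 0" and c0: "c 0 \<noteq> 0" and sq: "summable (\<lambda>k. (c k)\<^sup>2)"
    and lim: "(\<lambda>m. \<integral>\<^sup>+x. ennreal (((\<Sum>k\<le>m. c' k * Y (t - int k) x) - W (t - 1) x)\<^sup>2) \<partial>M) \<longlonglongrightarrow> 0"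
      (is "?I \<longlonglongrightarrow> 0")
  shows "c' \<longlonglongrightarrow> 0"
proof -
  define \<kappa> where "\<kappa> = v * (c 0)\<^sup>2 / 4"
  have \<kappa>: "\<kappa> > 0" using v c0 by (simp add: \<kappa>_def)
  let ?U = "\<lambda>m x. (\<Sum>k\<le>m. c' k * Y (t - int k) x) - W (t - 1) x"
  have bound: "ennreal (\<kappa> * (c' (Suc m))\<^sup>2) \<le> 2 * ?I (Suc m) + 2 * ?I m" for m
  proof -
    have "ennreal (\<kappa> * (c' (Suc m))\<^sup>2) = ennreal ((c' (Suc m))\<^sup>2) * ennreal \<kappa>"
      using \<kappa> by (simp add: ennreal_mult mult.commute)
    also have "\<dots> \<le> ennreal ((c' (Suc m))\<^sup>2) * (\<integral>\<^sup>+x. ennreal ((Y (t - int (Suc m)) x)\<^sup>2) \<partial>M)"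
      unfolding \<kappa>_def by (intro mult_left_mono second_moment_lower_bound sq) auto
    also have "\<dots> = (\<integral>\<^sup>+x. ennreal ((?U (Suc m) x - ?U m x)\<^sup>2) \<partial>M)"
      by (simp add: nn_integral_cmult[symmetric] ennreal_mult[symmetric] power_mult_distrib)
    also have "\<dots> \<le> (\<integral>\<^sup>+x. ennreal 2 * ennreal ((?U (Suc m) x)\<^sup>2) + ennreal 2 * ennreal ((?U m x)\<^sup>2) \<partial>M)"
    proof (rule nn_integral_mono)
      fix x
      have "ennreal ((u - u')\<^sup>2) \<le> ennreal 2 * ennreal (u\<^sup>2) + ennreal 2 * ennreal (u'\<^sup>2)"
        for u u' :: real
      proof -
        have "(u - u')\<^sup>2 \<le> 2 * u\<^sup>2 + 2 * u'\<^sup>2"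
          using zero_le_power2[of "u + u'"] by (simp add: power2_eq_square algebra_simps)
        then show ?thesis
          by (simp flip: ennreal_mult ennreal_plus add: ennreal_leI del: ennreal_numeral)
      qed
      then show "ennreal ((?U (Suc m) x - ?U m x)\<^sup>2) \<le>
          ennreal 2 * ennreal ((?U (Suc m) x)\<^sup>2) + ennreal 2 * ennreal ((?U m x)\<^sup>2)" .
    qed
    also have "\<dots> = 2 * ?I (Suc m) + 2 * ?I m"
      by (simp add: nn_integral_add nn_integral_cmult del: sum.atMost_Suc)
    finally show ?thesis .
  qed
  have "(\<lambda>m. 2 * ?I (Suc m) + 2 * ?I m) \<longlonglongrightarrow> 2 * 0 + 2 * 0"
    by (intro tendsto_add ennreal_tendsto_cmult lim LIMSEQ_Suc[OF lim]) auto
  then have "(\<lambda>m. 2 * ?I (Suc m) + 2 * ?I m) \<longlonglongrightarrow> 0" by simp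
  then have "(\<lambda>m. ennreal (\<kappa> * (c' (Suc m))\<^sup>2)) \<longlonglongrightarrow> 0"
    by (rule tendsto_sandwich[where f = "\<lambda>_. 0", rotated 3]) (use bound in simp_all)
  then have "(\<lambda>m. \<kappa> * (c' (Suc m))\<^sup>2) \<longlonglongrightarrow> 0"
    using \<kappa> by (subst (asm) tendsto_ennreal_iff[where x = 0, simplified]) auto
  then have "(\<lambda>m. (1 / \<kappa>) * (\<kappa> * (c' (Suc m))\<^sup>2)) \<longlonglongrightarrow> 0" by (rule tendsto_mult_right_zero)
  then have "(\<lambda>m. (c' (Suc m))\<^sup>2) \<longlonglongrightarrow> 0" using \<kappa> by simp
  then have "(\<lambda>m. c' (Suc m)) \<longlonglongrightarrow> 0" by (simp add: tendsto_null_power)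
  then show ?thesis by (rule LIMSEQ_imp_Suc)
qed

end

section \<open>The log-volatility of an SFIEGARCH process\<close>

context sfiegarch begin

abbreviation "innov \<equiv> \<lambda>t. g_fun M \<theta> \<gamma> (Z t)"
definition "innov_var = expectation (\<lambda>x. (innov 0 x)\<^sup>2)"

lemma Z_measurable [measurable]: "Z t \<in> borel_measurable M"
  using Z_indep unfolding indep_vars_def2 by simp

text \<open>
  All \<open>innov t\<close> are the same function of \<open>Z t\<close>: the centring constant is taken at time 0, as
  \<open>E|Z\<^sub>t|\<close> is the same for all times. Independence and identical distribution pass on from \<open>Z\<close> in this
  form.
\<close>

lemma innov_eq:
  "innov t = (\<lambda>x. \<theta> * Z t x + \<gamma> * (\<bar>Z t x\<bar> - expectation (\<lambda>y. \<bar>Z 0 y\<bar>)))"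
proof -
  have "expectation (\<lambda>y. \<bar>Z t y\<bar>) = expectation (\<lambda>y. \<bar>Z 0 y\<bar>)"
    using integral_distr[of "Z t" M borel abs] integral_distr[of "Z 0" M borel abs]
    by (simp add: Z_ident[of t 0])
  then show ?thesis by (simp add: g_fun_def fun_eq_iff)
qed

lemma innov_measurable [measurable]: "innov t \<in> borel_measurable M"
  unfolding innov_eq by measurable

lemma innov_indep: "indep_vars (\<lambda>_. borel) innov UNIV"
  unfolding innov_eq by (rule indep_vars_compose2[OF Z_indep]) measurable

lemma innov_ident: "distr M borel (innov t) = distr M borel (innov 0)"
proof -
  define h where "h z = \<theta> * z + \<gamma> * (\<bar>z\<bar> - expectation (\<lambda>y. \<bar>Z 0 y\<bar>))" for z
  have [measurable]: "h \<in> borel_measurable borel" unfolding h_def by measurable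
  have "innov u = h \<circ> Z u" for u unfolding innov_eq by (simp add: h_def fun_eq_iff)
  then have "distr M borel (innov u) = distr (distr M borel (Z u)) borel h" for u
    by (simp add: distr_distr)
  then show ?thesis by (metis Z_ident)
qed

lemma innov_integrable: "integrable M (innov t)"
  unfolding innov_eq by (intro Bochner_Integration.integrable_add integrable_mult_right
      Bochner_Integration.integrable_diff integrable_abs Z_integrable) simp

lemma innov_mean: "expectation (innov t) = 0"
proof -
  have "expectation (innov t) = \<theta> * expectation (Z t) +
      \<gamma> * (expectation (\<lambda>x. \<bar>Z t x\<bar>) - expectation (\<lambda>x. \<bar>Z t x\<bar>))"
    unfolding g_fun_def using Z_integrable[of t] by (simp add: prob_space)
  then show ?thesis by (simp add: Z_mean)
qed

lemma innov_square_integrable: "integrable M (\<lambda>x. (innov t x)\<^sup>2)"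
proof -
  let ?m = "expectation (\<lambda>y. \<bar>Z 0 y\<bar>)"
  have "(innov t x)\<^sup>2 = (\<theta>\<^sup>2 + \<gamma>\<^sup>2) * (Z t x)\<^sup>2 + 2 * \<theta> * \<gamma> * (Z t x * \<bar>Z t x\<bar>)
      - 2 * \<theta> * \<gamma> * ?m * Z t x - 2 * \<gamma>\<^sup>2 * ?m * \<bar>Z t x\<bar> + \<gamma>\<^sup>2 * ?m\<^sup>2" for x
    using abs_mult_self_eq[of "Z t x"] unfolding innov_eq
    by (simp add: power2_eq_square algebra_simps)
  moreover have "integrable M (\<lambda>x. Z t x * \<bar>Z t x\<bar>)"
    by (rule Bochner_Integration.integrable_bound[OF Z_sq_integrable[of t]])
      (auto simp: abs_mult power2_eq_square)
  ultimately show ?thesis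
    using Z_integrable[of t] Z_sq_integrable[of t] by simp
qed

lemma innov_second_moment: "expectation (\<lambda>x. (innov t x)\<^sup>2) = innov_var"
  using integral_distr[of "innov t" M borel "\<lambda>z. z\<^sup>2"] integral_distr[of "innov 0" M borel "\<lambda>z. z\<^sup>2"]
  by (simp add: innov_var_def innov_ident[of t])

lemma innov_var_pos:
  assumes "\<not> (AE x in M. innov 0 x = 0)"
  shows "innov_var > 0"
proof -
  have "innov_var \<noteq> 0"
    using assms unfolding innov_var_def
    by (subst integral_nonneg_eq_0_iff_AE[OF innov_square_integrable]) auto
  moreover have "innov_var \<ge> 0" unfolding innov_var_def by simp
  ultimately show ?thesis by simp
qed

lemma innov_orthogonal:
  shows "integrable M (\<lambda>x. innov t x * innov u x)"
    and "expectation (\<lambda>x. innov t x * innov u x) = (if t = u then innov_var else 0)"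
proof -
  have "indep_var borel (innov t) borel (innov u)" if "t \<noteq> u"
    using indep_vars_sum[of "{u}" t innov] indep_vars_subset[OF innov_indep] that by simp
  then show "integrable M (\<lambda>x. innov t x * innov u x)"
    and "expectation (\<lambda>x. innov t x * innov u x) = (if t = u then innov_var else 0)"
    using innov_square_integrable[of t] innov_second_moment[of t]
    by (cases "t = u"; simp add: power2_eq_square indep_var_integrable indep_var_lebesgue_integral
        innov_integrable innov_mean)+
qed

lemma log_volatility_causal_linear_process:
  "causal_linear_process M innov (\<lambda>t x. ln ((\<sigma> t x)\<^sup>2) - \<omega>) lam innov_var"
proof unfold_locales
  have [measurable]: "\<sigma> t \<in> borel_measurable M" for t by (rule sigma_rv)
  show "(\<lambda>x. ln ((\<sigma> t x)\<^sup>2) - \<omega>) \<in> borel_measurable M" for t by measurable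
qed (use innov_orthogonal volatility in \<open>auto simp: innov_var_def\<close>)

lemma lam_square_summable:
  assumes "\<not> (AE x in M. innov 0 x = 0)"
  shows "summable (\<lambda>k. (lam k)\<^sup>2)"
proof (rule square_summable_if_AE_summable[where W = "\<lambda>k. innov (- 1 - int k)"])
  show "indep_vars (\<lambda>_. borel) (\<lambda>k. innov (- 1 - int k)) UNIV"
    by (rule indep_vars_reindex_inj[OF innov_indep]) (simp add: inj_def)
  show "distr M borel (innov (- 1 - int i)) = distr M borel (innov (- 1 - int 0))" for i
    by (metis innov_ident)
  show "AE x in M. summable (\<lambda>k. lam k * innov (- 1 - int k) x)"
    using volatility[of 0] by eventually_elim (auto simp: sums_iff)
qed (use innov_var_pos[OF assms] in
    \<open>simp_all add: innov_integrable innov_mean innov_square_integrable innov_second_moment\<close>)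

end

theorem theorem1p3:
  fixes M :: "'a measure"
    and X \<sigma> Z Y :: "int \<Rightarrow> 'a \<Rightarrow> real"
    and p q s :: nat
    and d \<omega> \<theta> \<gamma> :: real
    and a b lam lam_inv :: "nat \<Rightarrow> real"
    and t :: int
  assumes process: "sfiegarch M X \<sigma> Z p q s d \<omega> \<theta> \<gamma> a b lam"
    and not_both_zero: "\<not> (\<gamma> = 0 \<and> \<theta> = 0)"
    and nondegenerate: "\<not> (AE x in M. g_fun M \<theta> \<gamma> (Z 0) x = 0)"
    and alpha_nonzero: "\<And>z. norm z \<le> 1 \<Longrightarrow> poly (lag_poly p a) z \<noteq> 0"
    and Y_def: "\<And>t x. Y t x = ln ((\<sigma> t x)\<^sup>2) - \<omega>"
    and lam_inv_series: "series_on_unit_disc lam_inv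
           (\<lambda>z. poly (lag_poly q b) z / poly (lag_poly p a) z
                  * (1 - z ^ s) powr complex_of_real d)"
  shows "(\<forall>r::real. 0 < r \<and> r \<le> 2 \<longrightarrow>
            (\<lambda>m. \<integral>\<^sup>+ x. ennreal (\<bar>(\<Sum>k\<le>m. lam_inv k * Y (t - int k) x)
                                    - g_fun M \<theta> \<gamma> (Z (t - 1)) x\<bar> powr r) \<partial>M)
              \<longlonglongrightarrow> 0)
         \<longleftrightarrow> d \<in> {-1<..<1/2}"
proof -
  interpret sfiegarch M X \<sigma> Z p q s d \<omega> \<theta> \<gamma> a b lam by (rule process)
  have Y: "Y = (\<lambda>t x. ln ((\<sigma> t x)\<^sup>2) - \<omega>)" by (simp add: Y_def fun_eq_iff)
  interpret causal_linear_process M innov Y lam innov_var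
    unfolding Y by (rule log_volatility_causal_linear_process)
  interpret filter: seasonal_fractional_filter "lag_poly p a" "lag_poly q b" s "- d" lam
    by unfold_locales (use s_pos alpha_nonzero beta_nonzero lam_series in auto)
  interpret inverse_filter: seasonal_fractional_filter "lag_poly q b" "lag_poly p a" s d lam_inv
    by unfold_locales (use s_pos alpha_nonzero beta_nonzero lam_inv_series in auto)
  have inv: "(\<Sum>k\<le>n. lam_inv k * lam (n - k)) = (if n = 0 then 1 else 0)" for n
    by (rule inverse_filter_convolution
        [OF filter.seasonal_fractional_filter_axioms inverse_filter.seasonal_fractional_filter_axioms])
  have v: "innov_var > 0" by (rule innov_var_pos[OF nondegenerate])
  let ?U = "\<lambda>m x. (\<Sum>k\<le>m. lam_inv k * Y (t - int k) x) - innov (t - 1) x"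
  show ?thesis
  proof
    assume L: "\<forall>r::real. 0 < r \<and> r \<le> 2 \<longrightarrow>
        (\<lambda>m. \<integral>\<^sup>+ x. ennreal (\<bar>?U m x\<bar> powr r) \<partial>M) \<longlonglongrightarrow> 0"
    have sq: "summable (\<lambda>k. (lam k)\<^sup>2)" by (rule lam_square_summable[OF nondegenerate])
    have "- d > -1/2" by (rule filter.exponent_if_square_summable[OF sq])
    moreover have "d > -1"
    proof (rule inverse_filter.exponent_if_null, rule inversion_coefficients_null[OF v _ sq])
      show "lam 0 \<noteq> 0" using inv[of 0] by auto
      have "(\<lambda>m. \<integral>\<^sup>+ x. ennreal (\<bar>?U m x\<bar> powr 2) \<partial>M) \<longlonglongrightarrow> 0"
        using L[rule_format, of 2] by simp
      then show "(\<lambda>m. \<integral>\<^sup>+ x. ennreal ((?U m x)\<^sup>2) \<partial>M) \<longlonglongrightarrow> 0" by simp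
    qed
    ultimately show "d \<in> {-1<..<1/2}" by simp
  next
    assume "d \<in> {-1<..<1/2}"
    then have d: "-1 < d" "d < 1/2" by auto
    obtain C where C: "C > 0" "\<And>k. \<bar>lam k\<bar> \<le> C * real (k + 1) powr (d - 1)"
      using filter.coefficient_bound by auto
    obtain C' where C': "C' > 0" "\<And>k. \<bar>lam_inv k\<bar> \<le> C' * real (k + 1) powr (- d - 1)"
      using inverse_filter.coefficient_bound by auto
    \<comment> \<open>The square root normalises the tail sum \<open>\<Sum>\<^bsub>j>N\<^esub> (j+1)\<^bsup>2d-2\<^esup> \<le> (N+1)\<^bsup>2d-1\<^esup> / (1 - 2d)\<close>, so that
      \<open>r N\<close> bounds the \<open>l\<^sup>2\<close> norm of the tail of \<open>lam\<close> beyond \<open>N\<close>.\<close>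
    define D where "D = C / sqrt (1 - 2 * d)"
    have D: "D > 0" "D\<^sup>2 = C\<^sup>2 / (1 - 2 * d)" using C d by (auto simp: D_def power_divide)
    define r where "r N = D * real (N + 1) powr (d - 1/2)" for N
    define w where "w k = C' * real (k + 1) powr (- d - 1)" for k
    have tail: "(\<Sum>j\<in>{N<..m}. (lam j)\<^sup>2) \<le> (r N)\<^sup>2" if "N \<le> m" for N m
    proof -
      have "(lam j)\<^sup>2 \<le> C\<^sup>2 * real (j + 1) powr (- (2 - 2 * d))" for j
      proof -
        have "(lam j)\<^sup>2 \<le> (C * real (j + 1) powr (d - 1))\<^sup>2"
          using C(2)[of j] by (intro power2_le_iff_abs_le[THEN iffD2]) auto
        also have "\<dots> = C\<^sup>2 * real (j + 1) powr (- (2 - 2 * d))"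
          by (simp add: power_mult_distrib power2_eq_square algebra_simps flip: powr_add)
        finally show ?thesis .
      qed
      then have "(\<Sum>j\<in>{N<..m}. (lam j)\<^sup>2) \<le> C\<^sup>2 * (\<Sum>j\<in>{N<..m}. real (j + 1) powr (- (2 - 2 * d)))"
        unfolding sum_distrib_left by (intro sum_mono)
      also have "\<dots> \<le> C\<^sup>2 * (real (N + 1) powr (1 - (2 - 2 * d)) / (2 - 2 * d - 1))"
        using d that by (intro mult_left_mono powr_tail_bound) auto
      also have "\<dots> = (r N)\<^sup>2"
        unfolding r_def power_mult_distrib D(2)
        by (simp add: power2_eq_square algebra_simps flip: powr_add)
      finally show ?thesis .
    qed
    define e where "e m = innov_var * (\<Sum>k\<le>m. w k * r (m - k))\<^sup>2" for m
    have pos: "0 < w k" "0 < r k" for k using C' D by (auto simp: w_def r_def)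
    have e_pos: "e m > 0" for m
      using v pos by (auto simp: e_def intro!: mult_pos_pos zero_less_power sum_pos)
    have "(\<lambda>m. \<Sum>k\<le>m. real (k + 1) powr (- (d + 1)) * real (m - k + 1) powr (- (1/2 - d))) \<longlonglongrightarrow> 0"
      using d by (intro powr_convolution_tendsto_0) auto
    from tendsto_mult_right_zero[OF this, of "C' * D"]
    have "(\<lambda>m. \<Sum>k\<le>m. w k * r (m - k)) \<longlonglongrightarrow> 0"
      by (simp add: w_def r_def sum_distrib_left mult_ac)
    then have "(\<lambda>m. innov_var * (\<Sum>k\<le>m. w k * r (m - k))\<^sup>2) \<longlonglongrightarrow> innov_var * 0\<^sup>2"
      by (intro tendsto_intros)
    then have e_lim: "e \<longlonglongrightarrow> 0" by (simp add: e_def[abs_def])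
    have moment: "(\<integral>\<^sup>+ x. ennreal ((?U m x)\<^sup>2) \<partial>M) \<le> ennreal (e m)" for m
      unfolding e_def using C'(2)
      by (intro truncated_inversion_error inv pos tail) (auto simp: w_def)
    show "\<forall>r::real. 0 < r \<and> r \<le> 2 \<longrightarrow> (\<lambda>m. \<integral>\<^sup>+ x. ennreal (\<bar>?U m x\<bar> powr r) \<partial>M) \<longlonglongrightarrow> 0"
    proof (intro allI impI)
      fix \<rho> :: real
      assume \<rho>: "0 < \<rho> \<and> \<rho> \<le> 2"
      have bound: "(\<integral>\<^sup>+ x. ennreal (\<bar>?U m x\<bar> powr \<rho>) \<partial>M) \<le> ennreal (2 * e m powr (\<rho> / 2))" for m
        using \<rho> by (intro absolute_moment_bound_of_second_moment e_pos moment) auto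
      have "(\<lambda>m. e m powr (\<rho> / 2)) \<longlonglongrightarrow> 0 powr (\<rho> / 2)"
        using \<rho> e_lim e_pos by (intro tendsto_powr') (auto intro!: always_eventually less_imp_le)
      from tendsto_ennrealI[OF tendsto_mult_right_zero[of _ _ 2]] this
      have "(\<lambda>m. ennreal (2 * e m powr (\<rho> / 2))) \<longlonglongrightarrow> 0" by force
      then show "(\<lambda>m. \<integral>\<^sup>+ x. ennreal (\<bar>?U m x\<bar> powr \<rho>) \<partial>M) \<longlonglongrightarrow> 0"
        by (rule tendsto_sandwich[where f = "\<lambda>_. 0", rotated 3]) (use bound in simp_all)
    qed
  qed
qed

end
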